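(* In the setting described in the context, let $h$ denote the (random) channel of the single-antenna ($N_t=N_r=1$) system and let $\mathcal{M}(\mathsf{SNR})=C_{N_t,N_r}(\mathsf{SNR})/C_{1,1}(\mathsf{SNR})$ be the finite-SNR multiplexing gain. Then for any $\alpha\in[0,1]$, $$\frac{\mathbb{E}\{\|\mathbf{H}\|_F^2\}}{N_t\,\mathbb{E}\{|h|^2\}}\le\lim_{\mathsf{SNR}\to0}\mathcal{M}(\mathsf{SNR})\le\frac{\mathbb{E}\{\|\mathbf{H}\|_2^2\}}{\mathbb{E}\{|h|^2\}},$$ $$M\le\lim_{\mathsf{SNR}\to\infty}\mathcal{M}(\mathsf{SNR})\le M\,\frac{\log_2(1+\frac{N_t}{M\kappa^2})}{\log_2(1+\frac1{\kappa^2})},$$ where $M=\min(N_t,N_r)$, $\|\cdot\|_F$ is the Frobenius norm and $\|\cdot\|_2$ the spectral norm. The upper bounds are achieved for deterministic channels (with full rank and $\alpha=1$). The lower bounds are achieved for right-rotationally invariant channel distributions (i.e., $\mathbb{H}$ and $\mathbb{H}\mathbf{U}$ equal in distribution for every unitary $\mathbf{U}$).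
   Context: Setting (MIMO channel with transmitter impairments). Let $N_t,N_r\ge1$, $\mathsf{SNR}>0$. The received signal is $\mathbf{y}=\sqrt{\mathsf{SNR}}\,\mathbf{H}(\mathbf{x}+\boldsymbol{\eta}_t)+\mathbf{n}\in\mathbb{C}^{N_r}$, where $\mathbf{x}\in\mathbb{C}^{N_t}$ has covariance $\mathbf{Q}=\mathbb{E}\{\mathbf{x}\mathbf{x}^H\}$ with $\mathrm{tr}(\mathbf{Q})=1$; $\mathbf{n}\sim\mathcal{CN}(\mathbf{0},\mathbf{I})$; the channel $\mathbf{H}\in\mathbb{C}^{N_r\times N_t}$ is a random matrix $\mathbb{H}$ with distribution $f_{\mathbb{H}}$ satisfying $\mathbb{E}\{\mathrm{tr}(\mathbf{H}^H\mathbf{H})\}=N_tN_r$ and $\mathrm{rank}(\mathbf{H})=\min(N_t,N_r)$ almost surely (a deterministic channel is the special case of a point-mass distribution). The distortion $\boldsymbol{\eta}_t\sim\mathcal{CN}(\mathbf{0},\boldsymbol{\Upsilon}_t(\mathbf{Q}))$ is independent of $\mathbf{x},\mathbf{n},\mathbf{H}$, with $\boldsymbol{\Upsilon}_t(\mathbf{Q})=\mathrm{diag}(\upsilon_1(q_1),\dots,\upsilon_{N_t}(q_{N_t}))$, $q_n=[\mathbf{Q}]_{nn}$, $\upsilon_n(q_n)=\kappa^2\big((1-\alpha)q_n+\alpha\frac{1}{N_t}\sum_{i}q_i\big)$, $\alpha\in[0,1]$, $\kappa>0$ (the same $\kappa$ is used for the single-antenna system). The receiver knows the realization $\mathbf{H}$,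 the transmitter only $f_{\mathbb{H}}$. Capacity: $C_{N_t,N_r}(\mathsf{SNR})=\sup_{f_{\mathbb{X}}:\ \mathrm{tr}(\mathbb{E}\{\mathbf{x}\mathbf{x}^H\})=1}\mathbb{E}_{\mathbf{H}}\{\mathcal{I}(\mathbf{x};\mathbf{y}\mid\mathbb{H}=\mathbf{H})\}$, which equals $\sup_{\mathbf{Q}\succeq\mathbf{0},\,\mathrm{tr}(\mathbf{Q})=1}\mathbb{E}_{\mathbf{H}}\{\log_2\det(\mathbf{I}+\mathsf{SNR}\,\mathbf{H}\mathbf{Q}\mathbf{H}^H(\mathsf{SNR}\,\mathbf{H}\boldsymbol{\Upsilon}_t(\mathbf{Q})\mathbf{H}^H+\mathbf{I})^{-1})\}$; $C_{1,1}$ is the same quantity for $N_t=N_r=1$ with channel $h$. *)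

theory Defs
  imports "HOL-Probability.Probability"
begin

text \<open>Complex matrices: an N_r x N_t matrix is complex^'t^'r (rows indexed by 'r,
  columns by 't), so N_t = CARD('t), N_r = CARD('r).\<close>

definition cjt :: "complex^'n^'m \<Rightarrow> complex^'m^'n" where
  "cjt A = (\<chi> i j. cnj (A $ j $ i))"

definition psd :: "complex^'n^'n \<Rightarrow> bool" where
  "psd Q \<longleftrightarrow> cjt Q = Q \<and> (\<forall>x. 0 \<le> Re (\<Sum>i\<in>UNIV. cnj (x $ i) * (Q *v x) $ i))"

definition unitary :: "complex^'n^'n \<Rightarrow> bool" where
  "unitary U \<longleftrightarrow> U ** cjt U = mat 1 \<and> cjt U ** U = mat 1"

definition frob_sq :: "complex^'n^'m \<Rightarrow> real" where
  "frob_sq A = (\<Sum>i\<in>UNIV. \<Sum>j\<in>UNIV. (cmod (A $ i $ j))\<^sup>2)"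

definition spec_norm :: "complex^'n^'m \<Rightarrow> real" where
  "spec_norm A = onorm (\<lambda>x. A *v x)"

definition Upsilon :: "real \<Rightarrow> real \<Rightarrow> complex^'t^'t \<Rightarrow> complex^'t^'t" where
  "Upsilon \<alpha> \<kappa> Q = (\<chi> i j. if i = j then
      complex_of_real (\<kappa>\<^sup>2 * ((1 - \<alpha>) * Re (Q $ i $ i)
        + \<alpha> * (1 / real CARD('t)) * (\<Sum>k\<in>UNIV. Re (Q $ k $ k))))
     else 0)"

text \<open>Rate for covariance Q and channel realization H
  (the determinant is real positive; we take its modulus).\<close>
definition rate :: "real \<Rightarrow> real \<Rightarrow> real \<Rightarrow> complex^'t^'t \<Rightarrow> complex^'t^'r \<Rightarrow> real" where
  "rate \<alpha> \<kappa> snr Q H = log 2 (cmod (det (mat 1 + (snr *\<^sub>R (H ** Q ** cjt H)) **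
      matrix_inv (snr *\<^sub>R (H ** Upsilon \<alpha> \<kappa> Q ** cjt H) + mat 1))))"

definition capacity :: "real \<Rightarrow> real \<Rightarrow> (complex^'t^'r) measure \<Rightarrow> real \<Rightarrow> real" where
  "capacity \<alpha> \<kappa> M snr =
     (SUP Q\<in>{Q::complex^'t^'t. psd Q \<and> trace Q = 1}. \<integral>H. rate \<alpha> \<kappa> snr Q H \<partial>M)"

definition channel :: "(complex^'t^'r) measure \<Rightarrow> bool" where
  "channel M \<longleftrightarrow> prob_space M \<and> sets M = sets borel \<and>
     integrable M frob_sq \<and>
     (\<integral>H. frob_sq H \<partial>M) = real CARD('t) * real CARD('r) \<and>
     (AE H in M. rank H = min CARD('t) CARD('r))"

definition right_rot_inv :: "(complex^'t^'r) measure \<Rightarrow> bool" where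
  "right_rot_inv M \<longleftrightarrow> (\<forall>U::complex^'t^'t. unitary U \<longrightarrow> distr M borel (\<lambda>H. H ** U) = M)"

end

theory Submission
  imports Defs
begin

text \<open>
  Write the rate as the logarithm of \<open>det (1 + A B\<^sup>-\<^sup>1)\<close> with \<open>A = s H Q H\<^sup>*\<close> and
  \<open>B = 1 + s H \<Upsilon> H\<^sup>*\<close>, which is a sum of \<open>ln (1 + x\<^sub>i)\<close> over the generalized eigenvalues
  of the pair \<open>(A, B)\<close>; at most \<open>min N\<^sub>t N\<^sub>r\<close> of them are nonzero.

  For \<open>s \<rightarrow> 0\<close> the rate is at most \<open>s tr (H Q H\<^sup>*)\<close> and asymptotically equal to it, so the
  capacity has slope \<open>sup\<^sub>Q E tr (H Q H\<^sup>*)\<close>. For \<open>s \<rightarrow> \<infinity>\<close> the rate increases in \<open>s\<close>,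
  hence the limit exists; concavity of \<open>ln\<close> and
  \<open>tr (A B\<^sup>-\<^sup>1) \<le> \<Sum>\<^sub>n q\<^sub>n / \<upsilon>\<^sub>n \<le> N\<^sub>t / \<kappa>\<^sup>2\<close> bound it from above, the uniform
  covariance bounds it from below.

  If the channel is right-rotationally invariant, invariance under sign flips and coordinate swaps
  makes \<open>E (H\<^sup>* F(H) H)\<close> diagonal, respectively scalar, for suitable \<open>F\<close>. This gives the slope
  and the bound \<open>E tr (A B\<^sup>-\<^sup>1) \<le> N\<^sub>r / \<kappa>\<^sup>2\<close>, for which the uniform covariance is optimal.
  A deterministic channel attains the upper bounds with a rank-one covariance, respectively with
  the normalized projection onto its row space.
\<close>

subsection \<open>Complex matrices\<close>

text \<open>No limit is interchanged with the supremum over covariances. A single covariance bounds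
  the capacity from below through dominated convergence, and the upper estimates hold for every
  covariance at every positive SNR. For one antenna pair the lower and upper bounds coincide, so the
  denominator of the gain has an exact slope and an exact limit.

  The hard case is an invariant channel with N_t > N_r: the pointwise trace bound is then too large,
  and only the mean trace is small enough. The inverse of the noise covariance depends on the
  diagonal of the input covariance; it survives sign flips of the channel, but in general not
  coordinate swaps. So flips first replace the input covariance by its diagonal. The distortion
  splits into \<kappa>^2 (1 - \<alpha>) times that same diagonal and an isotropic rest; a tangent
  estimate removes the first part, and the rest is invariant under all unitaries. The contributions
  (1 - \<alpha>) N_r / \<kappa>^2 and \<alpha> N_r / \<kappa>^2 add up to N_r / \<kappa>^2.\<close>

definition hdot :: "complex^'n \<Rightarrow> complex^'n \<Rightarrow> complex" where
  "hdot x y = (\<Sum>i\<in>UNIV. cnj (x $ i) * y $ i)"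

text \<open>The entries are real, so these matrices are Hermitian and can carry eigenvalues without
  a side condition.\<close>

definition dg :: "('n \<Rightarrow> real) \<Rightarrow> complex^'n^'n" where
  "dg d = (\<chi> i j. if i = j then of_real (d i) else 0)"

lemma cjt_nth [simp]: "cjt A $ i $ j = cnj (A $ j $ i)"
  by (simp add: cjt_def)

lemma cjt_mult [simp]: "cjt (A ** B) = cjt B ** cjt A"
  by (simp add: vec_eq_iff matrix_matrix_mult_def mult.commute)

lemma cjt_cjt [simp]: "cjt (cjt A) = A"
  by (simp add: vec_eq_iff)

lemma cjt_add [simp]: "cjt (A + B) = cjt A + cjt B"
  by (simp add: vec_eq_iff)

lemma cjt_diff [simp]: "cjt (A - B) = cjt A - cjt B"
  by (simp add: vec_eq_iff)

lemma cjt_scaleR [simp]: "cjt (r *\<^sub>R A) = r *\<^sub>R cjt A"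
  by (simp add: vec_eq_iff)

lemma cjt_mat_1 [simp]: "cjt (mat 1) = mat 1"
  by (simp add: vec_eq_iff mat_def)

lemma cjt_dg [simp]: "cjt (dg d) = dg d"
  by (simp add: vec_eq_iff dg_def)

lemma dg_add: "dg a + dg b = dg (\<lambda>i. a i + b i)"
  by (simp add: vec_eq_iff dg_def)

lemma dg_diff: "dg a - dg b = dg (\<lambda>i. a i - b i)"
  by (simp add: vec_eq_iff dg_def)

lemma dg_scaleR: "r *\<^sub>R dg a = dg (\<lambda>i. r * a i)"
  by (auto simp add: vec_eq_iff dg_def scaleR_conv_of_real[where 'a=complex])

lemma dg_1: "dg (\<lambda>i. 1) = mat 1"
  by (simp add: vec_eq_iff dg_def mat_def)

lemma mult_dg_nth: "(A ** dg d) $ i $ j = A $ i $ j * of_real (d j)"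
  by (simp add: matrix_matrix_mult_def dg_def if_distrib cong: if_cong)

lemma dg_mult_nth: "(dg d ** A) $ i $ j = of_real (d i) * A $ i $ j"
  by (simp add: matrix_matrix_mult_def dg_def if_distrib[of "\<lambda>z. z * _"] cong: if_cong)

lemma dg_mult: "dg a ** dg b = dg (\<lambda>i. a i * b i)"
  by (simp add: vec_eq_iff mult_dg_nth) (simp add: dg_def)

lemma dg_vec_nth: "(dg d *v x) $ i = of_real (d i) * x $ i"
  by (simp add: matrix_vector_mult_def dg_def if_distrib[of "\<lambda>z. z * _"] cong: if_cong)

lemma det_dg: "det (dg d) = of_real (\<Prod>i\<in>UNIV. d i)"
  by (subst det_diagonal) (auto simp: dg_def)

lemma trace_dg: "trace (dg d) = of_real (\<Sum>i\<in>UNIV. d i)"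
  by (simp add: trace_def dg_def)

lemma mult_add_left: "(A + B) ** C = A ** C + B ** (C :: 'a::semiring_1^'n^'m)"
  by (simp add: vec_eq_iff matrix_matrix_mult_def distrib_right sum.distrib)

lemma mult_add_right: "C ** (A + B) = C ** A + C ** (B :: 'a::semiring_1^'n^'m)"
  by (simp add: vec_eq_iff matrix_matrix_mult_def distrib_left sum.distrib)

lemma mult_diff_left: "(A - B) ** C = A ** C - B ** (C :: 'a::ring_1^'n^'m)"
  by (simp add: vec_eq_iff matrix_matrix_mult_def left_diff_distrib sum_subtractf)

lemma mult_diff_right: "C ** (A - B) = C ** A - C ** (B :: 'a::ring_1^'n^'m)"
  by (simp add: vec_eq_iff matrix_matrix_mult_def right_diff_distrib sum_subtractf)

lemma mult_scaleR_left: "(r *\<^sub>R A) ** B = r *\<^sub>R (A ** (B :: complex^'n^'m))"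
  by (simp add: scalar_matrix_assoc)

lemma mult_scaleR_right: "A ** (r *\<^sub>R B) = r *\<^sub>R (A ** (B :: complex^'n^'m))"
  by (simp add: matrix_scalar_ac scalar_matrix_assoc)

lemma trace_scaleR: "trace (r *\<^sub>R A) = r *\<^sub>R trace (A :: complex^'n^'n)"
  by (simp add: trace_def scaleR_sum_right)

subsection \<open>The Hermitian form\<close>

lemma hdot_mult_vec: "hdot x (A *v y) = hdot (cjt A *v x) y"
proof -
  have "hdot x (A *v y) = (\<Sum>i\<in>UNIV. \<Sum>j\<in>UNIV. cnj (x $ i) * A $ i $ j * y $ j)"
    by (simp add: hdot_def matrix_vector_mult_def sum_distrib_left mult.assoc)
  also have "\<dots> = (\<Sum>j\<in>UNIV. \<Sum>i\<in>UNIV. cnj (x $ i) * A $ i $ j * y $ j)"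
    by (rule sum.swap)
  also have "\<dots> = hdot (cjt A *v x) y"
    by (simp add: hdot_def matrix_vector_mult_def sum_distrib_left sum_distrib_right mult_ac)
  finally show ?thesis .
qed

lemma hdot_mult_vec_left: "hdot (A *v x) y = hdot x (cjt A *v y)"
  by (simp add: hdot_mult_vec)

lemma hdot_cnj: "cnj (hdot x y) = hdot y x"
  by (simp add: hdot_def mult.commute)

lemma hdot_add_right: "hdot x (y + z) = hdot x y + hdot x z"
  by (simp add: hdot_def algebra_simps sum.distrib)

lemma hdot_diff_right: "hdot x (y - z) = hdot x y - hdot x z"
  by (simp add: hdot_def algebra_simps sum_subtractf)

lemma hdot_add_left: "hdot (y + z) x = hdot y x + hdot z x"
  by (simp add: hdot_def algebra_simps sum.distrib)

lemma hdot_smult_right: "hdot x (c *s y) = c * hdot x y"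
  by (simp add: hdot_def algebra_simps sum_distrib_left)

lemma hdot_smult_left: "hdot (c *s y) x = cnj c * hdot y x"
  by (simp add: hdot_def algebra_simps sum_distrib_left)

lemma hdot_0 [simp]: "hdot 0 x = 0" "hdot x 0 = 0"
  by (simp_all add: hdot_def)

lemma hdot_self: "hdot x x = of_real ((norm x)\<^sup>2)"
proof -
  have "hdot x x = (\<Sum>i\<in>UNIV. of_real ((cmod (x $ i))\<^sup>2))"
    unfolding hdot_def by (rule sum.cong) (auto simp: complex_norm_square mult.commute simp del: of_real_power)
  then show ?thesis
    by (simp add: norm_vec_def L2_set_def sum_nonneg)
qed

lemma hdot_self_eq_0: "hdot x x = 0 \<longleftrightarrow> x = 0"
  by (simp add: hdot_self)

lemma psd_iff: "psd Q \<longleftrightarrow> cjt Q = Q \<and> (\<forall>x. 0 \<le> Re (hdot x (Q *v x)))"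
  by (simp add: psd_def hdot_def)

lemma psd_hermitian: "psd Q \<Longrightarrow> cjt Q = Q"
  by (simp add: psd_def)

lemma psd_ge_0: "psd Q \<Longrightarrow> 0 \<le> Re (hdot x (Q *v x))"
  by (simp add: psd_iff)

lemma psd_conj:
  assumes "psd A" shows "psd (S ** A ** cjt S)"
  unfolding psd_iff
proof (intro conjI allI)
  show "cjt (S ** A ** cjt S) = S ** A ** cjt S"
    using psd_hermitian[OF assms] by (simp add: matrix_mul_assoc)
  fix x
  have "hdot x ((S ** A ** cjt S) *v x) = hdot (cjt S *v x) (A *v (cjt S *v x))"
    by (simp add: hdot_mult_vec_left matrix_vector_mul_assoc matrix_mul_assoc)
  then show "0 \<le> Re (hdot x ((S ** A ** cjt S) *v x))"
    using psd_ge_0[OF assms] by simp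
qed

lemma psd_add: "psd A \<Longrightarrow> psd B \<Longrightarrow> psd (A + B)"
  by (simp add: psd_iff matrix_vector_mult_add_rdistrib hdot_add_right)

lemma scaleR_vec: "(r *\<^sub>R A) *v x = of_real r *s (A *v (x::complex^'n))"
  by (simp add: vec_eq_iff matrix_vector_mult_def sum_distrib_left scaleR_conv_of_real[where 'a=complex] mult.assoc)

lemma psd_scaleR: "psd A \<Longrightarrow> 0 \<le> r \<Longrightarrow> psd (r *\<^sub>R A)"
  by (simp add: psd_iff scaleR_vec hdot_smult_right)

lemma Re_hdot_dg: "Re (hdot x (dg d *v x)) = (\<Sum>i\<in>UNIV. d i * (cmod (x $ i))\<^sup>2)"
  unfolding hdot_def Re_sum dg_vec_nth
  by (rule sum.cong) (auto simp: cmod_power2 algebra_simps power2_eq_square[of "Re _"] power2_eq_square[of "Im _"])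

lemma psd_dg: "(\<And>i. 0 \<le> d i) \<Longrightarrow> psd (dg d)"
  by (auto simp: psd_iff Re_hdot_dg intro!: sum_nonneg)

lemma psd_mat_1: "psd (mat 1)"
  using psd_dg[of "\<lambda>_. 1"] by (simp add: dg_1)

lemma psd_mult_cjt: "psd (H ** cjt H)"
  using psd_conj[OF psd_mat_1, of H] by simp

lemma psd_diag_nonneg:
  fixes A :: "complex^'n^'n"
  assumes "psd A" shows "0 \<le> Re (A $ i $ i)"
proof -
  have "hdot (axis i 1) y = y $ i" for y :: "complex^'n"
    by (simp add: hdot_def axis_def if_distrib[of cnj] if_distrib[of "\<lambda>z. z * _"] cong: if_cong)
  moreover have "(A *v axis i 1) $ i = A $ i $ i"
    by (simp add: matrix_vector_mult_def axis_def if_distrib cong: if_cong)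
  ultimately have "hdot (axis i 1) (A *v axis i 1) = A $ i $ i"
    by simp
  then show ?thesis using psd_ge_0[OF assms, of "axis i 1"] by simp
qed

lemma hermitian_diag_real:
  assumes "cjt A = A" shows "A $ i $ i = of_real (Re (A $ i $ i))"
proof -
  have "cnj (A $ i $ i) = A $ i $ i"
    using arg_cong[OF assms, of "\<lambda>A. A $ i $ i"] by simp
  then show ?thesis by (simp add: complex_eq_iff)
qed

lemma psd_trace_nonneg: "psd A \<Longrightarrow> 0 \<le> Re (trace A)"
  by (simp add: trace_def sum_nonneg psd_diag_nonneg)

subsection \<open>The spectral theorem\<close>

text \<open>This makes a maximizer of the Rayleigh quotient on an invariant subspace \<open>W\<close> an eigenvector.\<close>

lemma psd_null_vector_orth:
  assumes "cjt P = P" and nonneg: "\<And>x. x \<in> W \<Longrightarrow> 0 \<le> Re (hdot x (P *v x))"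
    and W: "\<And>x y c. x \<in> W \<Longrightarrow> y \<in> W \<Longrightarrow> x + c *s y \<in> W"
    and v: "v \<in> W" "Re (hdot v (P *v v)) = 0" and w: "w \<in> W"
  shows "hdot w (P *v v) = 0"
proof (rule ccontr)
  assume nz: "hdot w (P *v v) \<noteq> 0"
  define a where "a = hdot w (P *v v)"
  define q where "q = Re (hdot w (P *v w))"
  \<comment> \<open>Chosen so that \<open>t * q \<le> 1\<close>: the quadratic term in
    \<open>t\<close> then undoes at most half of the linear decrease, and the form at
    \<open>x\<close> becomes negative.\<close>
  define t where "t = 1 / (q + 1)"
  have q: "0 \<le> q" using nonneg[OF w] by (simp add: q_def)
  define x where "x = v + (- of_real t * a) *s w"
  have cross: "hdot v (P *v w) = cnj a"
    unfolding a_def by (metis assms(1) hdot_cnj hdot_mult_vec)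
  have "hdot (v + c *s w) (P *v (v + c *s w))
      = hdot v (P *v v) + c * cnj a + cnj c * a + cnj c * c * hdot w (P *v w)" for c
    by (simp add: matrix_vector_right_distrib vec.scale hdot_add_left hdot_add_right
        hdot_smult_left hdot_smult_right cross a_def[symmetric] algebra_simps)
  from this[of "- of_real t * a"] have "hdot x (P *v x) = hdot v (P *v v) + (- of_real t * a) * cnj a
      + cnj (- of_real t * a) * a + cnj (- of_real t * a) * (- of_real t * a) * hdot w (P *v w)"
    unfolding x_def .
  also have "\<dots> = hdot v (P *v v) - 2 * of_real t * of_real ((cmod a)\<^sup>2)
      + of_real (t\<^sup>2 * (cmod a)\<^sup>2) * hdot w (P *v w)"
    unfolding of_real_mult complex_norm_square by (simp add: algebra_simps power2_eq_square)
  finally have "Re (hdot x (P *v x)) = - 2 * t * (cmod a)\<^sup>2 + t\<^sup>2 * (cmod a)\<^sup>2 * q"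
    using v(2) by (simp add: q_def)
  moreover have "0 \<le> Re (hdot x (P *v x))"
    unfolding x_def by (rule nonneg[OF W[OF v(1) w]])
  moreover have "t\<^sup>2 * (cmod a)\<^sup>2 * q \<le> t * (cmod a)\<^sup>2"
  proof -
    have "t * q \<le> 1" "0 \<le> t" using q by (simp_all add: t_def field_simps)
    then have "(t * q) * (t * (cmod a)\<^sup>2) \<le> 1 * (t * (cmod a)\<^sup>2)"
      by (intro mult_right_mono) auto
    then show ?thesis by (simp add: power2_eq_square mult_ac)
  qed
  moreover have "0 < t * (cmod a)\<^sup>2"
    using q nz by (simp add: t_def a_def)
  ultimately show False by simp
qed

text \<open>Index sets replace dimension counts: an index outside \<open>I\<close> leaves a zero row
  in the square matrix of the conditions, which is therefore singular and has a kernel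
  vector.\<close>

lemma exists_orth:
  fixes v :: "'n \<Rightarrow> complex^'n"
  assumes "j \<notin> I"
  shows "\<exists>x. x \<noteq> 0 \<and> (\<forall>i\<in>I. hdot (v i) x = 0)"
proof -
  define A :: "complex^'n^'n" where "A = (\<chi> i k. if i \<in> I then cnj (v i $ k) else 0)"
  have "row j A = 0"
    using assms by (simp add: A_def row_def vec_eq_iff)
  then have "det A = 0" by (rule det_zero_row(2))
  then have "\<not> invertible A" by (simp add: invertible_det_nz)
  then have "\<not> (\<forall>x. A *v x = 0 \<longrightarrow> x = 0)"
    by (simp add: invertible_left_inverse matrix_left_invertible_ker)
  then obtain x where x: "x \<noteq> 0" "A *v x = 0" by blast
  have "hdot (v i) x = 0" if "i \<in> I" for i
  proof -
    have "(A *v x) $ i = hdot (v i) x"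
      using that by (simp add: A_def matrix_vector_mult_def hdot_def)
    then show ?thesis using x by simp
  qed
  with x show ?thesis by blast
qed

text \<open>Induction on \<open>I\<close>: the Rayleigh quotient is maximized on the unit sphere of
  the orthogonal complement of the eigenvectors found so far. Indexing by the type \<open>'n\<close>
  itself makes the case \<open>I = UNIV\<close> a full eigenbasis.\<close>

lemma orthonormal_eigenvectors:
  fixes Q :: "complex^'n^'n" and I :: "'n set"
  assumes Q: "cjt Q = Q"
  shows "\<exists>v d. (\<forall>i\<in>I. \<forall>j\<in>I. hdot (v i) (v j) = (if i = j then 1 else 0)) \<and>
    (\<forall>i\<in>I. Q *v v i = of_real (d i) *s v i)"
proof -
  have "finite I" by simp
  then show ?thesis
  proof (induction I rule: finite_induct)
    case empty
    then show ?case by simp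
  next
    case (insert j I)
    then obtain v d where v: "\<forall>i\<in>I. \<forall>j\<in>I. hdot (v i) (v j) = (if i = j then 1 else 0)"
      and d: "\<forall>i\<in>I. Q *v v i = of_real (d i) *s v i"
      by blast
    define W where "W = {x. \<forall>i\<in>I. hdot (v i) x = 0}"
    define S where "S = W \<inter> {x. norm x = 1}"
    have W_add: "x + c *s y \<in> W" if "x \<in> W" "y \<in> W" for x y c
      using that by (simp add: W_def hdot_add_right hdot_smult_right)
    have W_smult: "c *s y \<in> W" if "y \<in> W" for y c
      using that by (simp add: W_def hdot_smult_right)
    obtain x0 where x0: "x0 \<noteq> 0" "x0 \<in> W"
      using exists_orth[OF insert.hyps(2), of v] by (auto simp: W_def)
    have normalize: "of_real (1 / norm x) *s x \<in> S" if "x \<in> W" "x \<noteq> 0" for x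
    proof -
      have "norm (of_real (1 / norm x) *s x) = norm ((1 / norm x) *\<^sub>R x)"
        by (rule arg_cong[of _ _ norm]) (simp add: vec_eq_iff scaleR_conv_of_real[where 'a=complex])
      also have "\<dots> = 1" using that by simp
      finally show ?thesis using W_smult[OF that(1)] by (simp add: S_def)
    qed
    have "S \<noteq> {}" using normalize[OF x0(2,1)] by blast
    moreover have "compact S"
    proof -
      have "W = (\<Inter>i\<in>I. {x. hdot (v i) x = 0})"
        by (auto simp: W_def)
      moreover have "closed {x. hdot (v i) x = 0}" for i
        unfolding hdot_def by (intro closed_Collect_eq continuous_intros)
      ultimately have "closed W" by (simp add: closed_INT)
      moreover have "{x :: complex^'n. norm x = 1} = sphere 0 1"
        by (simp add: sphere_def)
      ultimately show ?thesis
        unfolding S_def using compact_sphere closed_Int_compact by metis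
    qed
    moreover have "continuous_on S (\<lambda>x. Re (hdot x (Q *v x)))"
      unfolding hdot_def matrix_vector_mult_def
      by (auto intro!: continuous_intros)
    ultimately obtain u where u: "u \<in> S"
      and max: "\<And>x. x \<in> S \<Longrightarrow> Re (hdot x (Q *v x)) \<le> Re (hdot u (Q *v u))"
      using continuous_attains_sup[of S "\<lambda>x. Re (hdot x (Q *v x))"] by blast
    define l where "l = Re (hdot u (Q *v u))"
    \<comment> \<open>Since \<open>l\<close> is the maximal Rayleigh quotient on \<open>W\<close>,
      the form of \<open>P\<close> is nonnegative on \<open>W\<close> and vanishes at
      \<open>u\<close>.\<close>
    define P where "P = dg (\<lambda>_. l) - Q"
    have P_vec: "P *v x = of_real l *s x - Q *v x" for x
      unfolding P_def by (simp add: matrix_vector_mult_diff_rdistrib vec_eq_iff dg_vec_nth)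
    have Re_P: "Re (hdot x (P *v x)) = l * (norm x)\<^sup>2 - Re (hdot x (Q *v x))" for x
      by (simp add: P_vec hdot_diff_right hdot_smult_right hdot_self)
    have u1: "norm u = 1" "u \<in> W" using u by (auto simp: S_def)
    have nonneg: "0 \<le> Re (hdot x (P *v x))" if "x \<in> W" for x
    proof (cases "x = 0")
      case False
      let ?c = "of_real (1 / norm x) :: complex"
      have "Re (hdot (?c *s x) (Q *v (?c *s x))) \<le> l"
        unfolding l_def by (rule max[OF normalize[OF that False]])
      also have "hdot (?c *s x) (Q *v (?c *s x)) = ?c * ?c * hdot x (Q *v x)"
        by (simp only: vec.scale hdot_smult_left hdot_smult_right complex_cnj_complex_of_real mult.assoc)
      also have "Re \<dots> = Re (hdot x (Q *v x)) / (norm x)\<^sup>2"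
        by (simp add: power2_eq_square of_real_mult[symmetric] of_real_divide[symmetric] del: of_real_mult of_real_divide)
      finally show ?thesis
        using False by (simp add: Re_P field_simps)
    qed simp
    have P_herm: "cjt P = P" using Q by (simp add: P_def)
    have "Re (hdot u (P *v u)) = 0" using u1 by (simp add: Re_P l_def)
    then have orth: "hdot w (P *v u) = 0" if "w \<in> W" for w
      using psd_null_vector_orth[of P W u w] P_herm nonneg W_add u1 that by blast
    \<comment> \<open>The complement \<open>W\<close> is invariant, so \<open>P *v u\<close> may
      itself be used as the test vector \<open>w\<close>; it is orthogonal to itself and hence
      zero.\<close>
    have "P *v u \<in> W"
    proof -
      have "hdot (v i) (P *v u) = 0" if "i \<in> I" for i
      proof -
        have "hdot (v i) (P *v u) = hdot (P *v v i) u"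
          by (simp add: hdot_mult_vec P_herm)
        also have "P *v v i = of_real (l - d i) *s v i"
          using d that by (simp add: P_vec vec_eq_iff algebra_simps)
        finally show ?thesis
          using u1 that by (simp only: hdot_smult_left W_def mem_Collect_eq) simp
      qed
      then show ?thesis by (simp add: W_def)
    qed
    from orth[OF this] have "P *v u = 0" by (simp add: hdot_self_eq_0)
    then have Qu: "Q *v u = of_real l *s u" by (simp add: P_vec)
    have orth_u: "hdot (v i) u = 0" "hdot u (v i) = 0" if "i \<in> I" for i
    proof -
      show "hdot (v i) u = 0" using u1 that by (simp add: W_def)
      then show "hdot u (v i) = 0" using hdot_cnj[of "v i" u] by simp
    qed
    have uu: "hdot u u = 1" using u1 by (simp add: hdot_self)
    have "\<forall>i\<in>insert j I. \<forall>k\<in>insert j I. hdot ((v(j := u)) i) ((v(j := u)) k) = (if i = k then 1 else 0)"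
      using insert.hyps(2) v orth_u uu by auto
    moreover have "\<forall>i\<in>insert j I. Q *v (v(j := u)) i = of_real ((d(j := l)) i) *s (v(j := u)) i"
      using insert.hyps(2) d Qu by auto
    ultimately show ?case by blast
  qed
qed

theorem spectral_theorem:
  fixes Q :: "complex^'n^'n"
  assumes "cjt Q = Q"
  obtains U d where "unitary U" "Q = U ** dg d ** cjt U"
proof -
  obtain v :: "'n \<Rightarrow> complex^'n" and d :: "'n \<Rightarrow> real"
    where *: "\<forall>i\<in>UNIV. \<forall>j\<in>UNIV. hdot (v i) (v j) = (if i = j then 1 else 0)"
    "\<forall>i\<in>UNIV. Q *v v i = of_real (d i) *s v i"
    using orthonormal_eigenvectors[OF assms, of UNIV] by blast
  have v: "hdot (v i) (v j) = (if i = j then 1 else 0)" for i j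
    using *(1) by blast
  have d: "Q *v v i = of_real (d i) *s v i" for i
    using *(2) by blast
  define U where "U = (\<chi> i j. v j $ i)"
  have "cjt U ** U = mat 1"
    using v by (simp add: vec_eq_iff U_def matrix_matrix_mult_def mat_def hdot_def)
  then have U: "unitary U"
    using matrix_left_right_inverse[of "cjt U" U] by (simp add: unitary_def)
  have "Q ** U = U ** dg d"
  proof -
    have "(Q ** U) $ i $ j = (U ** dg d) $ i $ j" for i j
    proof -
      have "(Q ** U) $ i $ j = (Q *v v j) $ i"
        by (simp add: U_def matrix_matrix_mult_def matrix_vector_mult_def)
      also have "\<dots> = (U ** dg d) $ i $ j"
        unfolding d mult_dg_nth by (simp add: U_def)
      finally show ?thesis .
    qed
    then show ?thesis by (simp add: vec_eq_iff)
  qed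
  then have "U ** dg d ** cjt U = Q ** (U ** cjt U)"
    by (simp add: matrix_mul_assoc)
  then have "Q = U ** dg d ** cjt U"
    using U by (simp add: unitary_def)
  with U that show ?thesis by blast
qed

lemma psd_spectral:
  fixes Q :: "complex^'n^'n"
  assumes "psd Q"
  obtains U d where "unitary U" "Q = U ** dg d ** cjt U" "\<And>i. 0 \<le> d i"
proof -
  obtain U d where U: "unitary U" "Q = U ** dg d ** cjt U"
    using spectral_theorem[OF psd_hermitian[OF assms]] .
  have "cjt U ** Q ** U = (cjt U ** U) ** dg d ** (cjt U ** U)"
    unfolding U(2) by (simp add: matrix_mul_assoc)
  then have "cjt U ** Q ** cjt (cjt U) = dg d"
    using U(1) by (simp add: unitary_def)
  then have "psd (dg d)" using psd_conj[OF assms, of "cjt U"] by simp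
  then have "0 \<le> d i" for i
    using psd_diag_nonneg[of "dg d" i] by (simp add: dg_def)
  with U that show ?thesis by blast
qed

subsection \<open>Simultaneous diagonalization\<close>

lemma unitaryD: "unitary U \<Longrightarrow> U ** cjt U = mat 1" "unitary U \<Longrightarrow> cjt U ** U = mat 1"
  by (simp_all add: unitary_def)

lemma inverse_det_nonzero:
  fixes S T :: "complex^'n^'n"
  assumes "S ** T = mat 1"
  shows "det S * det T = 1" "det S \<noteq> 0" "det T \<noteq> 0"
proof -
  show "det S * det T = 1" by (metis assms det_I det_mul)
  then show "det S \<noteq> 0" "det T \<noteq> 0" by auto
qed

text \<open>\<open>matrix_inv\<close> chooses some two-sided inverse; for square matrices a right
  inverse already determines it. Inverses are computed in this way below.\<close>

lemma matrix_inv_eqI: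
  fixes A B :: "complex^'n^'n"
  assumes "A ** B = mat 1"
  shows "matrix_inv A = B"
proof -
  have BA: "B ** A = mat 1" using assms matrix_left_right_inverse by blast
  have "A ** matrix_inv A = mat 1"
    unfolding matrix_inv_def
    by (rule someI2[of "\<lambda>C. A ** C = mat 1 \<and> C ** A = mat 1" B]) (use assms BA in auto)
  then have "B ** (A ** matrix_inv A) = B" by simp
  then show ?thesis by (simp add: matrix_mul_assoc BA)
qed

text \<open>Nonsingularity in place of strict positivity of the form: this is directly what inverses
  and quotients of determinants ask for.\<close>

definition pd :: "complex^'n^'n \<Rightarrow> bool" where
  "pd B \<longleftrightarrow> psd B \<and> det B \<noteq> 0"

lemma unitary_conj_shift:
  assumes "unitary U"
  shows "s *\<^sub>R (U ** dg d ** cjt U) + e *\<^sub>R mat 1 = U ** dg (\<lambda>i. s * d i + e) ** cjt U"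
proof -
  have "U ** dg (\<lambda>i. s * d i + e) ** cjt U = U ** (s *\<^sub>R dg d + e *\<^sub>R mat 1) ** cjt U"
    by (simp add: dg_1[symmetric] dg_scaleR dg_add)
  also have "\<dots> = s *\<^sub>R (U ** dg d ** cjt U) + e *\<^sub>R mat 1"
    using unitaryD[OF assms] by (simp add: mult_add_left mult_add_right mult_scaleR_left mult_scaleR_right)
  finally show ?thesis by simp
qed

lemma unitary_conj_mult:
  assumes "unitary U"
  shows "(U ** dg a ** cjt U) ** (U ** dg b ** cjt U) = U ** dg (\<lambda>i. a i * b i) ** cjt U"
proof -
  have "(U ** dg a ** cjt U) ** (U ** dg b ** cjt U) = U ** dg a ** (cjt U ** U) ** dg b ** cjt U"
    by (simp add: matrix_mul_assoc)
  also have "\<dots> = U ** (dg a ** dg b) ** cjt U"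
    using unitaryD[OF assms] by (simp add: matrix_mul_assoc)
  finally show ?thesis by (simp add: dg_mult)
qed

lemma unitary_conj_inv:
  assumes "unitary U" "\<And>i. d i \<noteq> 0"
  shows "matrix_inv (U ** dg d ** cjt U) = U ** dg (\<lambda>i. 1 / d i) ** cjt U"
  by (rule matrix_inv_eqI) (use assms in \<open>simp add: unitary_conj_mult dg_1 unitaryD\<close>)

lemma det_unitary_conj: "unitary U \<Longrightarrow> det (U ** A ** cjt U) = det A"
  using inverse_det_nonzero(1)[of U "cjt U"] by (simp add: det_mul unitaryD mult_ac)

lemma trace_unitary_conj: "unitary U \<Longrightarrow> trace (U ** A ** cjt U) = trace A"
  by (metis matrix_mul_assoc matrix_mul_lid trace_mul_sym unitaryD(2))

lemma pd_psd: "pd B \<Longrightarrow> psd B" by (simp add: pd_def)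

lemma pd_add_scaled:
  fixes P :: "complex^'n^'n"
  assumes "psd P" "0 < e"
  shows "pd (P + e *\<^sub>R mat 1)"
proof -
  obtain U d where U: "unitary U" "P = U ** dg d ** cjt U" "\<And>i. 0 \<le> d i"
    using psd_spectral[OF assms(1)] by blast
  have "P + e *\<^sub>R mat 1 = U ** dg (\<lambda>i. d i + e) ** cjt U"
    using unitary_conj_shift[OF U(1), of 1 d e] U(2) by simp
  moreover have "d i + e \<noteq> 0" for i using U(3)[of i] assms(2) by linarith
  ultimately have "det (P + e *\<^sub>R mat 1) \<noteq> 0"
    by (auto simp: det_unitary_conj[OF U(1)] det_dg simp flip: of_real_add)
  then show ?thesis
    using assms by (simp add: pd_def psd_add psd_scaleR psd_mat_1)
qed

lemma pd_add_1: "psd P \<Longrightarrow> pd (P + mat 1)"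
  using pd_add_scaled[of P 1] by simp

text \<open>\<open>S\<close> is the eigenbasis scaled by the square roots of the eigenvalues. It is
  not triangular; only the congruence matters here.\<close>

lemma pd_cholesky:
  fixes B :: "complex^'n^'n"
  assumes "pd B"
  obtains S T :: "complex^'n^'n" where "S ** T = mat 1" "T ** S = mat 1" "B = S ** cjt S"
proof -
  obtain U d where U: "unitary U" "B = U ** dg d ** cjt U" "\<And>i. 0 \<le> d i"
    using psd_spectral[OF pd_psd[OF assms]] by blast
  have "(\<Prod>i\<in>UNIV. d i) \<noteq> 0"
    using assms by (auto simp: pd_def U det_unitary_conj det_dg)
  then have d: "0 < d i" for i using U(3)[of i] by (simp add: order.not_eq_order_implies_strict)
  define S where "S = U ** dg (\<lambda>i. sqrt (d i))"
  define T where "T = dg (\<lambda>i. 1 / sqrt (d i)) ** cjt U"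
  have d': "sqrt (d i) \<noteq> 0" for i using d[of i] by simp
  have "S ** T = U ** (dg (\<lambda>i. sqrt (d i)) ** dg (\<lambda>i. 1 / sqrt (d i))) ** cjt U"
    by (simp add: S_def T_def matrix_mul_assoc)
  also have "\<dots> = mat 1" using d' by (simp add: dg_mult dg_1 unitaryD[OF U(1)])
  finally have ST: "S ** T = mat 1" .
  have "S ** cjt S = U ** (dg (\<lambda>i. sqrt (d i)) ** dg (\<lambda>i. sqrt (d i))) ** cjt U"
    by (simp add: S_def matrix_mul_assoc)
  also have "\<dots> = B" using U(3) by (simp add: U dg_mult)
  finally have "B = S ** cjt S" by simp
  with ST show ?thesis using that matrix_left_right_inverse[THEN iffD1, OF ST] by blast
qed

text \<open>After factoring \<open>B = R ** cjt R\<close>, the matrix \<open>T ** A ** cjt T\<close>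
  with \<open>T\<close> inverse to \<open>R\<close> is positive semidefinite; its eigenbasis
  \<open>V\<close> gives \<open>S = R ** V\<close>. The numbers \<open>x i\<close> are the
  eigenvalues of \<open>A ** matrix_inv B\<close>, so its trace is their sum and the determinant in
  the rate is the product of the \<open>1 + x i\<close>.\<close>

lemma simultaneous_diag:
  fixes A B :: "complex^'n^'n"
  assumes "pd B" "psd A"
  obtains S T :: "complex^'n^'n" and x where "S ** T = mat 1" "T ** S = mat 1" "B = S ** cjt S"
    "A = S ** dg x ** cjt S" "\<And>i. 0 \<le> x i"
proof -
  obtain R T :: "complex^'n^'n" where R: "R ** T = mat 1" "T ** R = mat 1" "B = R ** cjt R"
    using pd_cholesky[OF assms(1)] by blast
  obtain V x where V: "unitary V" "T ** A ** cjt T = V ** dg x ** cjt V" "\<And>i. 0 \<le> x i"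
    using psd_spectral[OF psd_conj[OF assms(2), of T]] by blast
  have cR: "cjt T ** cjt R = mat 1" using R(1) by (metis cjt_mat_1 cjt_mult)
  have "(R ** V) ** (cjt V ** T) = R ** (V ** cjt V) ** T" by (simp add: matrix_mul_assoc)
  also have "\<dots> = mat 1" using R by (simp add: unitaryD[OF V(1)])
  finally have 1: "(R ** V) ** (cjt V ** T) = mat 1" .
  have "(R ** V) ** cjt (R ** V) = R ** (V ** cjt V) ** cjt R" by (simp add: matrix_mul_assoc)
  also have "\<dots> = B" using R by (simp add: unitaryD[OF V(1)])
  finally have 2: "B = (R ** V) ** cjt (R ** V)" by simp
  have "(R ** V) ** dg x ** cjt (R ** V) = R ** (V ** dg x ** cjt V) ** cjt R"
    by (simp add: matrix_mul_assoc)
  also have "\<dots> = (R ** T) ** A ** (cjt T ** cjt R)"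
    unfolding V(2)[symmetric] by (simp add: matrix_mul_assoc)
  also have "\<dots> = A" using R cR by simp
  finally have 3: "A = (R ** V) ** dg x ** cjt (R ** V)" by simp
  have 4: "(cjt V ** T) ** (R ** V) = mat 1" by (rule matrix_left_right_inverse[THEN iffD1, OF 1])
  show ?thesis by (rule that[OF 1 4 2 3 V(3)])
qed

lemma inv_of_congruence:
  fixes S T :: "complex^'n^'n"
  assumes "S ** T = mat 1" "T ** S = mat 1"
  shows "matrix_inv (S ** cjt S) = cjt T ** T"
proof (rule matrix_inv_eqI)
  have "cjt S ** cjt T = mat 1" using assms(2) by (metis cjt_mat_1 cjt_mult)
  have "S ** cjt S ** (cjt T ** T) = S ** (cjt S ** cjt T) ** T" by (simp add: matrix_mul_assoc)
  also have "\<dots> = mat 1" using \<open>cjt S ** cjt T = mat 1\<close> assms by simp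
  finally show "S ** cjt S ** (cjt T ** T) = mat 1" .
qed

lemma congruence_mult_inv:
  fixes S T :: "complex^'n^'n"
  assumes "S ** T = mat 1" "T ** S = mat 1"
  shows "S ** dg x ** cjt S ** matrix_inv (S ** cjt S) = S ** dg x ** T"
proof -
  have "cjt S ** cjt T = mat 1" using assms(2) by (metis cjt_mat_1 cjt_mult)
  have "S ** dg x ** cjt S ** (cjt T ** T) = S ** dg x ** (cjt S ** cjt T) ** T"
    by (simp add: matrix_mul_assoc)
  also have "\<dots> = S ** dg x ** T" using \<open>cjt S ** cjt T = mat 1\<close> by simp
  finally show ?thesis by (simp add: inv_of_congruence[OF assms])
qed

lemma trace_similar:
  fixes S T :: "complex^'n^'n"
  assumes "T ** S = mat 1"
  shows "trace (S ** A ** T) = trace A"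
  by (metis assms matrix_mul_assoc matrix_mul_lid trace_mul_sym)

lemma simultaneous_diag_trace:
  fixes S T :: "complex^'n^'n"
  assumes "S ** T = mat 1" "T ** S = mat 1"
  shows "trace (S ** dg x ** cjt S ** matrix_inv (S ** cjt S)) = of_real (\<Sum>i\<in>UNIV. x i)"
  using trace_similar[OF assms(2)] by (simp add: congruence_mult_inv[OF assms] trace_dg)

lemma simultaneous_diag_det:
  fixes S T :: "complex^'n^'n"
  assumes "S ** T = mat 1" "T ** S = mat 1"
  shows "det (mat 1 + S ** dg x ** cjt S ** matrix_inv (S ** cjt S)) = of_real (\<Prod>i\<in>UNIV. 1 + x i)"
proof -
  have "mat 1 + S ** dg x ** T = S ** dg (\<lambda>i. 1 + x i) ** T"
    using assms(1) by (simp add: dg_add[of "\<lambda>_. 1" x, symmetric] dg_1 mult_add_left mult_add_right)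
  then have "det (mat 1 + S ** dg x ** T) = det S * det T * det (dg (\<lambda>i. 1 + x i))"
    by (simp add: det_mul)
  then show ?thesis
    using inverse_det_nonzero(1)[OF assms(1)]
    by (simp add: congruence_mult_inv[OF assms] det_dg)
qed

subsection \<open>Rank\<close>

lemma rank_mult_le_right:
  fixes A :: "complex^'n^'m" and B :: "complex^'p^'n"
  shows "rank (A ** B) \<le> rank B"
proof -
  have "row i (A ** B) \<in> vec.span (rows B)" for i
  proof -
    have "row i (A ** B) = (\<Sum>k\<in>UNIV. A $ i $ k *s row k B)"
      by (simp add: vec_eq_iff row_def matrix_matrix_mult_def)
    also have "\<dots> \<in> vec.span (rows B)"
      by (intro vec.span_sum vec.span_scale vec.span_base) (auto simp: rows_def)
    finally show ?thesis .
  qed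
  then have "rows (A ** B) \<subseteq> vec.span (rows B)" by (auto simp: rows_def)
  then have "vec.dim (rows (A ** B)) \<le> vec.dim (vec.span (rows B))" by (rule vec.dim_subset)
  then show ?thesis by (simp add: row_rank_def_gen)
qed

lemma rank_mult_le_left:
  fixes A :: "complex^'n^'m" and B :: "complex^'p^'n"
  shows "rank (A ** B) \<le> rank A"
proof -
  have "row i (A ** B) = transpose B *v row i A" for i
    by (simp add: vec_eq_iff row_def matrix_matrix_mult_def matrix_vector_mult_def transpose_def mult.commute)
  then have "rows (A ** B) = (\<lambda>v. transpose B *v v) ` rows A"
    by (auto simp: rows_def)
  then show ?thesis
    using vec.dim_image_le[OF matrix_vector_mul_linear_gen, of "transpose B" "rows A"]
    by (simp add: row_rank_def_gen)
qed

lemma rank_le_card_rows: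
  fixes A :: "complex^'n^'m"
  shows "rank A \<le> card {i. row i A \<noteq> 0}"
proof -
  let ?R = "(\<lambda>i. row i A) ` {i. row i A \<noteq> 0}"
  have "r \<in> vec.span ?R" if "r \<in> rows A" for r
    by (cases "r = 0") (use that in \<open>auto simp: rows_def vec.span_zero intro!: vec.span_base\<close>)
  then have "vec.dim (rows A) \<le> card ?R" by (intro vec.dim_le_card) auto
  also have "\<dots> \<le> card {i. row i A \<noteq> 0}" by (simp add: card_image_le)
  finally show ?thesis by (simp add: row_rank_def_gen)
qed

lemma rank_le_dims:
  fixes A :: "complex^'n^'m"
  shows "rank A \<le> min CARD('n) CARD('m)"
proof -
  have "rank A \<le> CARD('n)"
    using vec.dim_subset_UNIV[of "rows A"]
    by (simp add: row_rank_def_gen vec.dimension_def card_cart_basis)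
  moreover have "card {i. row i A \<noteq> 0} \<le> CARD('m)" by (intro card_mono) auto
  ultimately show ?thesis using rank_le_card_rows[of A] by simp
qed

lemma rank_dg: "card {i. x i \<noteq> 0} \<le> rank (dg x :: complex^'n^'n)"
proof -
  let ?E = "(\<lambda>i. axis i 1 :: complex^'n) ` {i. x i \<noteq> 0}"
  have "axis i 1 \<in> vec.span (rows (dg x :: complex^'n^'n))" if "x i \<noteq> 0" for i
  proof -
    have "axis i 1 = (1 / of_real (x i)) *s row i (dg x :: complex^'n^'n)"
      using that by (auto simp: vec_eq_iff axis_def row_def dg_def)
    then show ?thesis by (metis (mono_tags, lifting) rows_def mem_Collect_eq vec.span_base vec.span_scale UNIV_I)
  qed
  then have sub: "?E \<subseteq> vec.span (rows (dg x :: complex^'n^'n))" by auto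
  have "?E \<subseteq> cart_basis" by (auto simp: cart_basis_def)
  then have ind: "vec.independent ?E"
    using independent_cart_basis vec.independent_mono by blast
  have "card {i. x i \<noteq> 0} = card ?E"
    by (rule card_image[symmetric]) (simp add: inj_on_def axis_eq_axis)
  also have "\<dots> \<le> vec.dim (vec.span (rows (dg x :: complex^'n^'n)))"
    by (rule vec.independent_card_le_dim[OF sub ind])
  finally show ?thesis by (simp add: row_rank_def_gen)
qed

text \<open>Congruence with \<open>T\<close> recovers \<open>dg x\<close>, and products do not raise
  the rank. This limits how many generalized eigenvalues can be nonzero.\<close>

lemma card_support_le_rank:
  fixes S T :: "complex^'n^'n"
  assumes "T ** S = mat 1"
  shows "card {i. x i \<noteq> 0} \<le> rank (S ** dg x ** cjt S)"
proof -
  have "cjt S ** cjt T = mat 1" using assms by (metis cjt_mat_1 cjt_mult)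
  have "T ** (S ** dg x ** cjt S) ** cjt T = (T ** S) ** dg x ** (cjt S ** cjt T)"
    by (simp add: matrix_mul_assoc)
  then have "dg x = T ** (S ** dg x ** cjt S) ** cjt T"
    using assms \<open>cjt S ** cjt T = mat 1\<close> by simp
  then have "rank (dg x :: complex^'n^'n) \<le> rank (S ** dg x ** cjt S)"
    by (metis rank_mult_le_left rank_mult_le_right order_trans)
  then show ?thesis using rank_dg[of x] by simp
qed

text \<open>For the bound on the rank of \<open>H\<close>, the rows of \<open>cjt U ** H\<close>
  have squared norms \<open>d i\<close>, so each vanishing eigenvalue deletes a row.\<close>

lemma rank_gram:
  fixes H :: "complex^'t^'r"
  assumes U: "unitary U" and HH: "H ** cjt H = U ** dg d ** cjt U"
  shows "card {i. d i \<noteq> 0} = rank H"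
proof (rule antisym)
  have "card {i. d i \<noteq> 0} \<le> rank (U ** dg d ** cjt U)"
    by (rule card_support_le_rank[OF unitaryD(2)[OF U]])
  also have "\<dots> \<le> rank H" unfolding HH[symmetric] by (rule rank_mult_le_left)
  finally show "card {i. d i \<noteq> 0} \<le> rank H" .
  define W where "W = cjt U ** H"
  have "W ** cjt W = (cjt U ** U) ** dg d ** (cjt U ** U)"
    unfolding W_def using HH by (metis cjt_cjt cjt_mult matrix_mul_assoc)
  then have WW: "W ** cjt W = dg d" by (simp add: unitaryD[OF U])
  have "row i W = 0" if "d i = 0" for i
  proof -
    have "of_real (d i) = (\<Sum>k\<in>UNIV. W $ i $ k * cnj (W $ i $ k))"
      using arg_cong[OF WW, of "\<lambda>A. A $ i $ i"] by (simp add: dg_def matrix_matrix_mult_def)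
    also have "\<dots> = of_real (\<Sum>k\<in>UNIV. (cmod (W $ i $ k))\<^sup>2)"
      by (simp only: complex_norm_square of_real_sum)
    finally have "(\<Sum>k\<in>UNIV. (cmod (W $ i $ k))\<^sup>2) = 0"
      using that by (metis of_real_eq_iff)
    then show ?thesis by (simp add: sum_nonneg_eq_0_iff vec_eq_iff row_def)
  qed
  then have "card {i. row i W \<noteq> 0} \<le> card {i. d i \<noteq> 0}" by (intro card_mono) auto
  moreover have "U ** W = H" by (simp add: W_def matrix_mul_assoc unitaryD[OF U])
  then have "rank H \<le> rank W" by (metis rank_mult_le_right)
  ultimately show "rank H \<le> card {i. d i \<noteq> 0}"
    using rank_le_card_rows[of W] by simp
qed

subsection \<open>Traces\<close>

lemma conj_diag_nth:
  "(S ** dg x ** cjt S) $ i $ j = (\<Sum>k\<in>UNIV. of_real (x k) * S $ i $ k * cnj (S $ j $ k))"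
  by (subst matrix_matrix_mult_def) (simp add: mult_dg_nth mult_ac)

text \<open>In an eigenbasis of \<open>X\<close> the trace is a nonnegative combination of diagonal
  entries of a conjugate of \<open>Z\<close>. Applied to differences, this makes traces monotone in
  the Loewner order.\<close>

lemma trace_psd_mult_nonneg:
  fixes X Z :: "complex^'n^'n"
  assumes "psd X" "psd Z"
  shows "0 \<le> Re (trace (X ** Z))"
proof -
  obtain U d where U: "unitary U" "X = U ** dg d ** cjt U" "\<And>i. 0 \<le> d i"
    using psd_spectral[OF assms(1)] by blast
  have "trace (X ** Z) = trace (dg d ** (cjt U ** Z ** cjt (cjt U)))"
    unfolding U(2) by (metis cjt_cjt matrix_mul_assoc trace_mul_sym)
  also have "\<dots> = (\<Sum>i\<in>UNIV. of_real (d i) * (cjt U ** Z ** cjt (cjt U)) $ i $ i)"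
    by (simp add: trace_def dg_mult_nth)
  finally show ?thesis
    using U(3) psd_diag_nonneg[OF psd_conj[OF assms(2), of "cjt U"]] by (simp add: sum_nonneg)
qed

text \<open>Supplies the integrable majorant for single matrix entries when a random matrix is
  averaged entry by entry.\<close>

lemma psd_entry_le_trace:
  fixes P :: "complex^'n^'n"
  assumes "psd P"
  shows "cmod (P $ i $ j) \<le> Re (trace P)"
proof -
  obtain U d where U: "unitary U" "P = U ** dg d ** cjt U" "\<And>i. 0 \<le> d i"
    using psd_spectral[OF assms(1)] by blast
  have P: "P $ i $ j = (\<Sum>k\<in>UNIV. of_real (d k) * U $ i $ k * cnj (U $ j $ k))" for i j
    unfolding U(2) by (rule conj_diag_nth)
  have diag: "Re (P $ i $ i) = (\<Sum>k\<in>UNIV. d k * (cmod (U $ i $ k))\<^sup>2)" for i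
    by (simp add: P mult.assoc complex_norm_square[symmetric] del: of_real_power flip: of_real_power)
  have le: "Re (P $ i $ i) \<le> Re (trace P)" for i
    unfolding trace_def Re_sum
    by (rule member_le_sum) (auto simp: psd_diag_nonneg[OF assms])
  have amgm: "a * b \<le> (a\<^sup>2 + b\<^sup>2) / 2" for a b :: real
    using sum_squares_bound[of a b] by simp
  have "cmod (P $ i $ j) \<le> (\<Sum>k\<in>UNIV. d k * (cmod (U $ i $ k) * cmod (U $ j $ k)))"
    unfolding P by (rule order_trans[OF norm_sum]) (simp add: norm_mult U(3) mult.assoc)
  also have "\<dots> \<le> (\<Sum>k\<in>UNIV. d k * (((cmod (U $ i $ k))\<^sup>2 + (cmod (U $ j $ k))\<^sup>2) / 2))"
    by (intro sum_mono mult_left_mono U(3) amgm)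
  also have "\<dots> = (Re (P $ i $ i) + Re (P $ j $ j)) / 2"
    by (simp add: diag sum.distrib[symmetric] sum_divide_distrib algebra_simps add_divide_distrib)
  also have "\<dots> \<le> Re (trace P)" using le[of i] le[of j] by simp
  finally show ?thesis .
qed

lemma trace_mult_cjt: "trace (H ** cjt H) = of_real (frob_sq H)"
proof -
  have "trace (H ** cjt H) = (\<Sum>i\<in>UNIV. \<Sum>j\<in>UNIV. H $ i $ j * cnj (H $ i $ j))"
    by (simp add: trace_def matrix_matrix_mult_def)
  also have "\<dots> = of_real (frob_sq H)"
    by (simp only: complex_norm_square frob_sq_def of_real_sum)
  finally show ?thesis .
qed

text \<open>The eigenvalues of the inverse are \<open>1 / (s * d i + 1)\<close>, which lie between 0
  and 1: noise beyond the unit thermal noise can only lower the signal trace.\<close>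

lemma psd_inv_add_1:
  fixes P :: "complex^'n^'n"
  assumes "psd P" "0 \<le> s"
  shows "psd (matrix_inv (s *\<^sub>R P + mat 1))" "psd (mat 1 - matrix_inv (s *\<^sub>R P + mat 1))"
proof -
  obtain U d where U: "unitary U" "P = U ** dg d ** cjt U" "\<And>i. 0 \<le> d i"
    using psd_spectral[OF assms(1)] by blast
  have pos: "0 < s * d i + 1" for i using U(3)[of i] assms(2) by (simp add: add_nonneg_pos)
  have inv: "matrix_inv (s *\<^sub>R P + mat 1) = U ** dg (\<lambda>i. 1 / (s * d i + 1)) ** cjt U"
  proof -
    have "s * d i + 1 \<noteq> 0" for i using pos[of i] by simp
    then show ?thesis
      using unitary_conj_shift[OF U(1), of s d 1] unitary_conj_inv[OF U(1), of "\<lambda>i. s * d i + 1"]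
      by (simp add: U(2))
  qed
  show "psd (matrix_inv (s *\<^sub>R P + mat 1))"
    unfolding inv by (intro psd_conj psd_dg) (use pos less_imp_le in auto)
  have "mat 1 - matrix_inv (s *\<^sub>R P + mat 1)
      = U ** (dg (\<lambda>i. 1) - dg (\<lambda>i. 1 / (s * d i + 1))) ** cjt U"
    unfolding inv by (simp add: mult_diff_left mult_diff_right dg_1 unitaryD[OF U(1)])
  also have "psd \<dots>"
    unfolding dg_diff
    by (intro psd_conj psd_dg) (use pos U(3) assms(2) in simp)
  finally show "psd (mat 1 - matrix_inv (s *\<^sub>R P + mat 1))" .
qed

lemma trace_mult_inv_le:
  fixes A P :: "complex^'n^'n"
  assumes "psd A" "psd P" "0 \<le> s"
  shows "Re (trace (A ** matrix_inv (s *\<^sub>R P + mat 1))) \<le> Re (trace A)"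
  using trace_psd_mult_nonneg[OF assms(1) psd_inv_add_1(2)[OF assms(2,3)]]
  by (simp add: mult_diff_right trace_sub)

subsection \<open>The log-determinant ratio\<close>

lemma pd_inv:
  fixes B :: "complex^'n^'n"
  assumes "pd B"
  shows "B ** matrix_inv B = mat 1" "matrix_inv B ** B = mat 1" "psd (matrix_inv B)"
proof -
  obtain S T :: "complex^'n^'n" where S: "S ** T = mat 1" "T ** S = mat 1" "B = S ** cjt S"
    using pd_cholesky[OF assms] by blast
  have cS: "cjt S ** cjt T = mat 1" using S(2) by (metis cjt_mat_1 cjt_mult)
  have "B ** (cjt T ** T) = S ** (cjt S ** cjt T) ** T"
    by (simp add: S(3) matrix_mul_assoc)
  then have 1: "B ** (cjt T ** T) = mat 1" by (simp add: cS S(1))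
  then have inv: "matrix_inv B = cjt T ** T" by (rule matrix_inv_eqI)
  show "B ** matrix_inv B = mat 1" using 1 inv by simp
  then show "matrix_inv B ** B = mat 1" by (rule matrix_left_right_inverse[THEN iffD1])
  show "psd (matrix_inv B)"
    using psd_mult_cjt[of "cjt T"] by (simp add: inv)
qed

text \<open>The natural logarithm is used throughout; base two costs a factor
  \<open>1 / ln 2\<close>, which cancels in the multiplexing gain.\<close>

definition ldet :: "complex^'n^'n \<Rightarrow> complex^'n^'n \<Rightarrow> real" where
  "ldet A B = ln (cmod (det (mat 1 + A ** matrix_inv B)))"

lemma ln_1_plus_tangent:
  fixes x \<theta> :: real
  assumes "0 \<le> x" "0 < \<theta>"
  shows "ln (1 + x) \<le> ln \<theta> + (1 + x) / \<theta> - 1"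
proof -
  have "ln ((1 + x) / \<theta>) \<le> (1 + x) / \<theta> - 1"
    using assms by (intro ln_le_minus_one) auto
  then show ?thesis using assms by (simp add: ln_div)
qed

lemma ldet_nonneg:
  fixes A B :: "complex^'n^'n"
  assumes "pd B" "psd A"
  shows "0 \<le> ldet A B" "1 \<le> cmod (det (mat 1 + A ** matrix_inv B))"
proof -
  obtain S T :: "complex^'n^'n" and x where S: "S ** T = mat 1" "T ** S = mat 1"
    "B = S ** cjt S" "A = S ** dg x ** cjt S" "\<And>i. 0 \<le> x i"
    using simultaneous_diag[OF assms] by blast
  have "1 \<le> (\<Prod>i\<in>UNIV. 1 + x i)" using S(5) by (intro prod_ge_1) simp
  then show 1: "1 \<le> cmod (det (mat 1 + A ** matrix_inv B))"
    unfolding S(3,4) simultaneous_diag_det[OF S(1,2)] by (simp del: of_real_prod)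
  then show "0 \<le> ldet A B" unfolding ldet_def by (rule ln_ge_zero)
qed

text \<open>Each nonzero eigenvalue is bounded by the tangent of \<open>ln (1 + x)\<close> at
  \<open>x = \<theta> - 1\<close>. The result is linear in the trace, so it can be averaged over the
  channel with one fixed \<open>\<theta>\<close>.\<close>

lemma ldet_le_tangent:
  fixes A B :: "complex^'n^'n"
  assumes "pd B" "psd A" "rank A \<le> m" "1 \<le> \<theta>"
  shows "ldet A B \<le> real m * (ln \<theta> + 1 / \<theta> - 1) + Re (trace (A ** matrix_inv B)) / \<theta>"
proof -
  obtain S T :: "complex^'n^'n" and x where S: "S ** T = mat 1" "T ** S = mat 1"
    "B = S ** cjt S" "A = S ** dg x ** cjt S" "\<And>i. 0 \<le> x i"
    using simultaneous_diag[OF assms(1,2)] by blast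
  let ?I = "{i. x i \<noteq> 0}"
  have tr: "Re (trace (A ** matrix_inv B)) = (\<Sum>i\<in>UNIV. x i)"
    unfolding S(3,4) simultaneous_diag_trace[OF S(1,2)] by simp
  have pos: "0 < 1 + x i" for i using S(5)[of i] by simp
  have "ldet A B = ln (\<Prod>i\<in>UNIV. 1 + x i)"
    unfolding ldet_def S(3,4) simultaneous_diag_det[OF S(1,2)]
    using pos by (simp add: abs_prod less_imp_le del: of_real_prod)
  also have "\<dots> = (\<Sum>i\<in>UNIV. ln (1 + x i))" using pos by (subst ln_prod) (auto simp: less_imp_neq[THEN not_sym])
  also have "\<dots> = (\<Sum>i\<in>?I. ln (1 + x i))" by (rule sum.mono_neutral_right) auto
  also have "\<dots> \<le> (\<Sum>i\<in>?I. (ln \<theta> + 1 / \<theta> - 1) + x i / \<theta>)"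
  proof (rule sum_mono)
    fix i
    show "ln (1 + x i) \<le> (ln \<theta> + 1 / \<theta> - 1) + x i / \<theta>"
      using ln_1_plus_tangent[OF S(5)[of i], of \<theta>] assms(4) by (simp add: add_divide_distrib)
  qed
  also have "\<dots> = real (card ?I) * (ln \<theta> + 1 / \<theta> - 1) + (\<Sum>i\<in>?I. x i) / \<theta>"
    by (simp add: sum.distrib sum_divide_distrib)
  also have "(\<Sum>i\<in>?I. x i) = (\<Sum>i\<in>UNIV. x i)" by (rule sum.mono_neutral_left) auto
  \<comment> \<open>The tangent is nonnegative at \<open>x = 0\<close>, so counting more eigenvalues
    than are nonzero only weakens the bound.\<close>
  also have "real (card ?I) * (ln \<theta> + 1 / \<theta> - 1) \<le> real m * (ln \<theta> + 1 / \<theta> - 1)"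
  proof (rule mult_right_mono)
    have "card ?I \<le> rank A" unfolding S(4) by (rule card_support_le_rank[OF S(2)])
    then show "real (card ?I) \<le> real m" using assms(3) by simp
    have "ln (1 / \<theta>) \<le> 1 / \<theta> - 1" using assms(4) by (intro ln_le_minus_one) auto
    then show "0 \<le> ln \<theta> + 1 / \<theta> - 1" using assms(4) by (simp add: ln_div)
  qed
  finally show ?thesis by (simp add: tr)
qed

lemma ldet_le_trace:
  assumes "pd B" "psd A"
  shows "ldet A B \<le> Re (trace (A ** matrix_inv B))"
  using ldet_le_tangent[OF assms order_refl, of 1] by simp

text \<open>The tangent at the common value \<open>t / m\<close> gives Jensen's bound: for a given
  sum the logarithms are largest when the \<open>m\<close> eigenvalues are equal.\<close>

lemma ldet_le_rank:
  assumes "pd B" "psd A" "rank A \<le> m" "Re (trace (A ** matrix_inv B)) \<le> t" "0 < m"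
  shows "ldet A B \<le> real m * ln (1 + t / real m)"
proof -
  have "0 \<le> Re (trace (A ** matrix_inv B))"
    using ldet_nonneg(1)[OF assms(1,2)] ldet_le_trace[OF assms(1,2)] by simp
  then have t: "0 \<le> t" using assms(4) by simp
  let ?\<theta> = "1 + t / real m"
  have "1 \<le> ?\<theta>" using t by simp
  have "ldet A B \<le> real m * (ln ?\<theta> + 1 / ?\<theta> - 1) + Re (trace (A ** matrix_inv B)) / ?\<theta>"
    by (rule ldet_le_tangent[OF assms(1-3) \<open>1 \<le> ?\<theta>\<close>])
  also have "\<dots> \<le> real m * (ln ?\<theta> + 1 / ?\<theta> - 1) + t / ?\<theta>"
    using assms(4) \<open>1 \<le> ?\<theta>\<close> by (intro add_left_mono divide_right_mono) auto
  also have "\<dots> = real m * ln ?\<theta>"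
  proof -
    have "real m * (1 / ?\<theta> - 1) + t / ?\<theta> = 0"
      using assms(5) t by (simp add: field_simps add_pos_nonneg)
    then show ?thesis by (simp add: algebra_simps)
  qed
  finally show ?thesis .
qed

section \<open>Monotonicity of the log-determinant in the SNR\<close>

lemma det_add_eq:
  fixes A B :: "complex^'n^'n"
  assumes "pd B"
  shows "det (B + A) = det (mat 1 + A ** matrix_inv B) * det B"
proof -
  have "(mat 1 + A ** matrix_inv B) ** B = B + A ** (matrix_inv B ** B)"
    by (simp add: mult_add_left matrix_mul_assoc)
  then show ?thesis by (simp add: pd_inv[OF assms] flip: det_mul)
qed

text \<open>Mutual information as the entropy of the received signal minus the entropy of the noise;
  each determinant can then be expanded on its own.\<close>

lemma ldet_eq_diff:
  fixes A B :: "complex^'n^'n"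
  assumes "pd B" "psd A"
  shows "ldet A B = ln (cmod (det (B + A))) - ln (cmod (det B))"
proof -
  have "det B \<noteq> 0" using assms by (simp add: pd_def)
  moreover have "0 < cmod (det (mat 1 + A ** matrix_inv B))"
    using ldet_nonneg(2)[OF assms] by linarith
  ultimately show ?thesis
    by (simp add: ldet_def det_add_eq[OF assms(1)] norm_mult ln_mult)
qed

lemma det_pd_mono:
  assumes "pd B" "psd A"
  shows "cmod (det B) \<le> cmod (det (B + A))"
  using mult_right_mono[OF ldet_nonneg(2)[OF assms], of "cmod (det B)"]
  by (simp add: det_add_eq[OF assms(1)] norm_mult)

lemma continuous_on_det:
  fixes f :: "'a::topological_space \<Rightarrow> complex^'n^'n"
  assumes "continuous_on S f"
  shows "continuous_on S (\<lambda>x. det (f x))"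
  unfolding det_def using assms by (auto intro!: continuous_intros)

text \<open>The product \<open>A ** X\<close> is not Hermitian, but with
  \<open>A = S ** cjt S\<close> it is similar to \<open>cjt S ** X ** S\<close>. The determinant
  thus becomes that of a positive definite matrix, to which \<open>det_pd_mono\<close>
  applies.\<close>

lemma det_mult_mono_pd:
  fixes A K E :: "complex^'n^'n"
  assumes "pd A" "psd K" "psd E"
  shows "cmod (det (mat 1 + A ** K)) \<le> cmod (det (mat 1 + A ** (K + E)))"
proof -
  obtain S T :: "complex^'n^'n" where S: "S ** T = mat 1" "T ** S = mat 1" "A = S ** cjt S"
    using pd_cholesky[OF assms(1)] by blast
  have *: "det (mat 1 + A ** X) = det (cjt S ** X ** S + mat 1)" for X
  proof -
    have "S ** (cjt S ** X ** S + mat 1) ** T = A ** X ** (S ** T) + S ** T"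
      by (simp add: S(3) mult_add_left mult_add_right matrix_mul_assoc)
    then have "mat 1 + A ** X = S ** (cjt S ** X ** S + mat 1) ** T"
      by (simp add: S(1) add.commute)
    then show ?thesis
      using inverse_det_nonzero(1)[OF S(1)] by (simp add: det_mul mult_ac)
  qed
  have "pd (cjt S ** K ** S + mat 1)" "psd (cjt S ** E ** S)"
    using pd_add_1[OF psd_conj[OF assms(2), of "cjt S"]] psd_conj[OF assms(3), of "cjt S"] by auto
  from det_pd_mono[OF this] show ?thesis
    unfolding * by (simp add: mult_add_left mult_add_right add_ac)
qed

lemma continuous_on_matrix_mult [continuous_intros]:
  fixes f :: "'a::topological_space \<Rightarrow> complex^'n^'m" and g :: "'a \<Rightarrow> complex^'p^'n"
  assumes "continuous_on S f" "continuous_on S g"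
  shows "continuous_on S (\<lambda>x. f x ** g x)"
  unfolding matrix_matrix_mult_def
  by (intro continuous_on_vec_lambda continuous_on_sum continuous_on_mult continuous_on_component assms)

lemma det_mult_mono:
  fixes A K E :: "complex^'n^'n"
  assumes "psd A" "psd K" "psd E"
  shows "cmod (det (mat 1 + A ** K)) \<le> cmod (det (mat 1 + A ** (K + E)))"
proof -
  \<comment> \<open>A singular \<open>A\<close> is a limit of the positive definite matrices \<open>A + e 1\<close>.\<close>
  let ?f = "\<lambda>K (e::real). cmod (det (mat 1 + (A + e *\<^sub>R mat 1) ** K))"
  have cont: "continuous_on UNIV (?f K)" for K
    by (intro continuous_intros continuous_on_det)
  have "(?f K \<longlongrightarrow> ?f K 0) (at_right 0)" for K
    using cont[of K, unfolded continuous_on_def, rule_format, of 0]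
    by (simp only: UNIV_I simp_thms filterlim_at_split)
  moreover have "eventually (\<lambda>e. ?f K e \<le> ?f (K + E) e) (at_right 0)"
    using eventually_at_right_less
    by (rule eventually_mono) (intro det_mult_mono_pd assms pd_add_scaled)
  ultimately have "?f K 0 \<le> ?f (K + E) 0"
    by (intro tendsto_le[of "at_right 0" "?f (K + E)" _ "?f K"]) auto
  then show ?thesis by simp
qed

text \<open>The factor \<open>s\<close> is moved into the inverse: the eigenvalues of
  \<open>K s\<close> are \<open>s / (s * d i + 1)\<close>, which increase in \<open>s\<close> even
  where \<open>d i\<close> vanishes. So \<open>K t - K s\<close> is positive semidefinite.\<close>

lemma ldet_scale_mono:
  fixes A B :: "complex^'n^'n"
  assumes "psd A" "psd B" "0 < s" "s \<le> t"
  shows "ldet (s *\<^sub>R A) (s *\<^sub>R B + mat 1) \<le> ldet (t *\<^sub>R A) (t *\<^sub>R B + mat 1)"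
proof -
  obtain U d where U: "unitary U" "B = U ** dg d ** cjt U" "\<And>i. 0 \<le> d i"
    using psd_spectral[OF assms(2)] by blast
  define K where "K = (\<lambda>s. U ** dg (\<lambda>i. s / (s * d i + 1)) ** cjt U)"
  have inv: "(s *\<^sub>R A) ** matrix_inv (s *\<^sub>R B + mat 1) = A ** K s" if "0 < s" for s
  proof -
    have "s * d i + 1 \<noteq> 0" for i
      using U(3)[of i] that by (metis add_nonneg_pos less_irrefl mult_nonneg_nonneg less_imp_le zero_less_one)
    then have "matrix_inv (s *\<^sub>R B + mat 1) = U ** dg (\<lambda>i. 1 / (s * d i + 1)) ** cjt U"
      using unitary_conj_shift[OF U(1), of s d 1] unitary_conj_inv[OF U(1), of "\<lambda>i. s * d i + 1"]
      by (simp add: U(2))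
    moreover have "K s = s *\<^sub>R (U ** dg (\<lambda>i. 1 / (s * d i + 1)) ** cjt U)"
      proof -
      have "U ** (s *\<^sub>R dg (\<lambda>i. 1 / (s * d i + 1))) ** cjt U = s *\<^sub>R (U ** dg (\<lambda>i. 1 / (s * d i + 1)) ** cjt U)"
        by (simp add: mult_scaleR_left mult_scaleR_right)
      then show ?thesis by (simp add: K_def dg_scaleR)
    qed
    ultimately show ?thesis by (simp add: mult_scaleR_left mult_scaleR_right)
  qed
  have K: "psd (K s)"
    unfolding K_def using U(3) assms(3) by (intro psd_conj psd_dg divide_nonneg_nonneg) auto
  have "K t - K s = U ** (dg (\<lambda>i. t / (t * d i + 1)) - dg (\<lambda>i. s / (s * d i + 1))) ** cjt U"
    by (simp add: K_def mult_diff_left mult_diff_right)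
  also have "psd \<dots>"
    unfolding dg_diff
  proof (intro psd_conj psd_dg)
    fix i
    have "0 < s * d i + 1" "0 < t * d i + 1"
      using U(3)[of i] assms(3,4) by (auto intro!: add_nonneg_pos)
    moreover from this have "t / (t * d i + 1) - s / (s * d i + 1) = (t - s) / ((t * d i + 1) * (s * d i + 1))"
      by (subst diff_frac_eq) (auto simp: algebra_simps)
    ultimately show "0 \<le> t / (t * d i + 1) - s / (s * d i + 1)"
      using assms(4) by simp
  qed
  finally have "psd (K t - K s)" .
  from det_mult_mono[OF assms(1) K this]
  have le: "cmod (det (mat 1 + A ** K s)) \<le> cmod (det (mat 1 + A ** K t))" by simp
  have "1 \<le> cmod (det (mat 1 + A ** K s))"
    using ldet_nonneg(2)[of "s *\<^sub>R B + mat 1" "s *\<^sub>R A"] assms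
    by (simp add: inv psd_scaleR pd_add_1)
  then have "0 < cmod (det (mat 1 + A ** K s))" by linarith
  then have "ln (cmod (det (mat 1 + A ** K s))) \<le> ln (cmod (det (mat 1 + A ** K t)))"
    using le by (subst ln_le_cancel_iff) (linarith, linarith, assumption)
  then show ?thesis
    unfolding ldet_def using assms(3,4) by (simp add: inv)
qed

section \<open>Limits of the log-determinant at zero and at infinite SNR\<close>

lemma ln_1_plus_div_limit: "((\<lambda>s. ln (1 + s * d) / s) \<longlongrightarrow> d) (at_right (0::real))"
proof -
  have "((\<lambda>s. ln (1 + s * d)) has_field_derivative d) (at 0)"
    by (auto intro!: derivative_eq_intros)
  then have "((\<lambda>s. ln (1 + s * d) / s) \<longlongrightarrow> d) (at 0)"
    by (simp add: has_field_derivative_iff)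
  then show ?thesis by (simp add: filterlim_at_split)
qed

lemma ln_det_div_limit:
  fixes P :: "complex^'n^'n"
  assumes "psd P"
  shows "((\<lambda>s. ln (cmod (det (s *\<^sub>R P + mat 1))) / s) \<longlongrightarrow> Re (trace P)) (at_right 0)"
proof -
  obtain U d where U: "unitary U" "P = U ** dg d ** cjt U" "\<And>i. 0 \<le> d i"
    using psd_spectral[OF assms] by blast
  have "((\<lambda>s. \<Sum>i\<in>UNIV. ln (1 + s * d i) / s) \<longlongrightarrow> (\<Sum>i\<in>UNIV. d i)) (at_right 0)"
    by (intro tendsto_sum ln_1_plus_div_limit)
  moreover have "eventually (\<lambda>s. (\<Sum>i\<in>UNIV. ln (1 + s * d i) / s)
      = ln (cmod (det (s *\<^sub>R P + mat 1))) / s) (at_right 0)"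
    using eventually_at_right_less
  proof (rule eventually_mono)
    fix s :: real assume s: "0 < s"
    have pos: "0 < 1 + s * d i" for i using U(3)[of i] s by (simp add: add_pos_nonneg)
    have "det (s *\<^sub>R P + mat 1) = of_real (\<Prod>i\<in>UNIV. 1 + s * d i)"
      using unitary_conj_shift[OF U(1), of s d 1]
      by (simp add: U(2) det_unitary_conj[OF U(1)] det_dg add.commute)
    also have "cmod \<dots> = (\<Prod>i\<in>UNIV. 1 + s * d i)"
      using pos by (simp add: abs_prod less_imp_le flip: of_real_prod)
    finally show "(\<Sum>i\<in>UNIV. ln (1 + s * d i) / s) = ln (cmod (det (s *\<^sub>R P + mat 1))) / s"
      using pos by (simp add: ln_prod less_imp_neq[THEN not_sym] sum_divide_distrib)
  qed
  moreover have "Re (trace P) = (\<Sum>i\<in>UNIV. d i)"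
    by (simp add: U(2) trace_unitary_conj[OF U(1)] trace_dg)
  ultimately show ?thesis by (simp add: tendsto_cong)
qed

text \<open>Distortion has no first-order effect: the two determinants have slopes
  \<open>trace (B + A)\<close> and \<open>trace B\<close>, and the part of \<open>B\<close>
  cancels.\<close>

lemma ldet_div_limit:
  fixes A B :: "complex^'n^'n"
  assumes "psd A" "psd B"
  shows "((\<lambda>s. ldet (s *\<^sub>R A) (s *\<^sub>R B + mat 1) / s) \<longlongrightarrow> Re (trace A)) (at_right 0)"
proof -
  have "((\<lambda>s. ln (cmod (det (s *\<^sub>R (B + A) + mat 1))) / s - ln (cmod (det (s *\<^sub>R B + mat 1))) / s)
      \<longlongrightarrow> Re (trace (B + A)) - Re (trace B)) (at_right 0)"
    by (intro tendsto_diff ln_det_div_limit psd_add assms)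
  moreover have "eventually (\<lambda>s. ln (cmod (det (s *\<^sub>R (B + A) + mat 1))) / s - ln (cmod (det (s *\<^sub>R B + mat 1))) / s
      = ldet (s *\<^sub>R A) (s *\<^sub>R B + mat 1) / s) (at_right 0)"
    using eventually_at_right_less
  proof (rule eventually_mono)
    fix s :: real assume s: "0 < s"
    have "s *\<^sub>R B + mat 1 + s *\<^sub>R A = s *\<^sub>R (B + A) + mat 1" by (simp add: scaleR_add_right add_ac)
    then have "ldet (s *\<^sub>R A) (s *\<^sub>R B + mat 1)
      = ln (cmod (det (s *\<^sub>R (B + A) + mat 1))) - ln (cmod (det (s *\<^sub>R B + mat 1)))"
      using ldet_eq_diff[OF pd_add_1[OF psd_scaleR[OF assms(2)]] psd_scaleR[OF assms(1)], of s s] s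
      by (simp only: less_imp_le simp_thms)
    then show "ln (cmod (det (s *\<^sub>R (B + A) + mat 1))) / s - ln (cmod (det (s *\<^sub>R B + mat 1))) / s
      = ldet (s *\<^sub>R A) (s *\<^sub>R B + mat 1) / s"
      by (simp only: diff_divide_distrib)
  qed
  ultimately show ?thesis by (simp add: tendsto_cong trace_add)
qed

text \<open>Signal and distortion are multiples of the same Gram matrix, so one unitary diagonalizes
  both. At high SNR every nonzero eigenvalue contributes \<open>ln (1 + a / b)\<close> whatever its
  size, and there are \<open>rank H\<close> of them.\<close>

lemma ldet_gram_limit:
  fixes H :: "complex^'t^'r"
  assumes "0 \<le> a" "0 < b"
  shows "((\<lambda>s. ldet (s *\<^sub>R a *\<^sub>R (H ** cjt H)) (s *\<^sub>R b *\<^sub>R (H ** cjt H) + mat 1))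
    \<longlongrightarrow> real (rank H) * ln (1 + a / b)) at_top"
proof -
  obtain U d where U: "unitary U" "H ** cjt H = U ** dg d ** cjt U" "\<And>i. 0 \<le> d i"
    using psd_spectral[OF psd_mult_cjt[of H]] by blast
  have lim: "((\<lambda>s. ln (1 + s * a * d i / (s * b * d i + 1))) \<longlongrightarrow> (if d i = 0 then 0 else ln (1 + a / b))) at_top" for i
  proof (cases "d i = 0")
    case False
    then have di: "0 < d i" using U(3)[of i] by simp
    have "((\<lambda>s. a * d i / (b * d i + inverse s)) \<longlongrightarrow> a * d i / (b * d i + 0)) at_top"
      by (intro tendsto_intros tendsto_inverse_0_at_top filterlim_ident) (use di assms in simp)
    moreover have "eventually (\<lambda>s. a * d i / (b * d i + inverse s) = s * a * d i / (s * b * d i + 1)) at_top"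
      using eventually_gt_at_top[of 0]
    proof (rule eventually_mono)
      fix s :: real assume "0 < s"
      moreover have "0 < b * d i + inverse s" "0 < s * b * d i + 1"
        using di assms \<open>0 < s\<close> by (simp_all add: add_pos_pos)
      ultimately show "a * d i / (b * d i + inverse s) = s * a * d i / (s * b * d i + 1)"
        by (simp add: field_simps)
    qed
    ultimately have "((\<lambda>s. s * a * d i / (s * b * d i + 1)) \<longlongrightarrow> a / b) at_top"
      using di by (simp add: tendsto_cong)
    moreover have "1 + a / b \<noteq> 0" using assms by (metis add_pos_nonneg divide_nonneg_pos less_irrefl zero_less_one)
    ultimately show ?thesis using False by (auto intro!: tendsto_intros)
  qed simp
  have "((\<lambda>s. \<Sum>i\<in>UNIV. ln (1 + s * a * d i / (s * b * d i + 1)))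
    \<longlongrightarrow> (\<Sum>i\<in>UNIV. if d i = 0 then 0 else ln (1 + a / b))) at_top"
    by (intro tendsto_sum lim)
  also have "(\<Sum>i\<in>UNIV. if d i = 0 then 0 else ln (1 + a / b)) = (\<Sum>i\<in>{i. d i \<noteq> 0}. ln (1 + a / b))"
    by (rule sum.mono_neutral_cong_right) auto
  also have "\<dots> = real (rank H) * ln (1 + a / b)"
    by (simp add: rank_gram[OF U(1,2)])
  finally have main: "((\<lambda>s. \<Sum>i\<in>UNIV. ln (1 + s * a * d i / (s * b * d i + 1)))
    \<longlongrightarrow> real (rank H) * ln (1 + a / b)) at_top" .
  have "eventually (\<lambda>s. (\<Sum>i\<in>UNIV. ln (1 + s * a * d i / (s * b * d i + 1)))
      = ldet (s *\<^sub>R a *\<^sub>R (H ** cjt H)) (s *\<^sub>R b *\<^sub>R (H ** cjt H) + mat 1)) at_top"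
    using eventually_gt_at_top[of 0]
  proof (rule eventually_mono)
    fix s :: real assume s: "0 < s"
    have pos: "0 < s * b * d i + 1" for i
      using U(3)[of i] s assms by (intro add_nonneg_pos mult_nonneg_nonneg) auto
    have pos': "0 < 1 + s * a * d i / (s * b * d i + 1)" for i
    proof -
      have "0 \<le> s * a * d i / (s * b * d i + 1)"
        using U(3)[of i] s assms pos[of i] by (intro divide_nonneg_pos) auto
      then show ?thesis by linarith
    qed
    have "s * b * d i + 1 \<noteq> 0" for i using pos[of i] by simp
    then have inv: "matrix_inv (s *\<^sub>R b *\<^sub>R (H ** cjt H) + mat 1) = U ** dg (\<lambda>i. 1 / (s * b * d i + 1)) ** cjt U"
      using unitary_conj_shift[OF U(1), of "s * b" d 1] unitary_conj_inv[OF U(1), of "\<lambda>i. s * b * d i + 1"]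
      by (simp add: U(2))
    have sc: "s *\<^sub>R a *\<^sub>R (H ** cjt H) = U ** dg (\<lambda>i. s * a * d i) ** cjt U"
      using unitary_conj_shift[OF U(1), of "s * a" d 0] by (simp add: U(2))
    have "mat 1 + s *\<^sub>R a *\<^sub>R (H ** cjt H) ** matrix_inv (s *\<^sub>R b *\<^sub>R (H ** cjt H) + mat 1)
      = U ** dg (\<lambda>i. 1 + s * a * d i / (s * b * d i + 1)) ** cjt U"
      unfolding inv sc unitary_conj_mult[OF U(1)]
      using unitary_conj_shift[OF U(1), of 1 "\<lambda>i. s * a * d i * (1 / (s * b * d i + 1))" 1]
      by (simp add: add.commute)
    then have "cmod (det (mat 1 + s *\<^sub>R a *\<^sub>R (H ** cjt H) ** matrix_inv (s *\<^sub>R b *\<^sub>R (H ** cjt H) + mat 1)))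
      = (\<Prod>i\<in>UNIV. 1 + s * a * d i / (s * b * d i + 1))"
      using pos' by (simp add: det_unitary_conj[OF U(1)] det_dg abs_prod less_imp_le del: of_real_prod)
    then show "(\<Sum>i\<in>UNIV. ln (1 + s * a * d i / (s * b * d i + 1)))
      = ldet (s *\<^sub>R a *\<^sub>R (H ** cjt H)) (s *\<^sub>R b *\<^sub>R (H ** cjt H) + mat 1)"
      unfolding ldet_def using pos' by (simp add: ln_prod less_imp_neq[THEN not_sym])
  qed
  with main show ?thesis by (simp add: tendsto_cong)
qed

text \<open>Where \<open>\<upsilon>\<close> vanishes so does the numerator, and the summand is \<open>0 / 0 = 0\<close>.\<close>

lemma hdot_inv_bound:
  fixes H :: "complex^'t^'r"
  assumes \<upsilon>: "\<And>n. 0 \<le> \<upsilon> n" "\<And>n. \<upsilon> n = 0 \<Longrightarrow> v $ n = 0" and s: "0 < s"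
  shows "s * Re (hdot (H *v v) (matrix_inv (s *\<^sub>R (H ** dg \<upsilon> ** cjt H) + mat 1) *v (H *v v)))
    \<le> (\<Sum>n\<in>UNIV. (cmod (v $ n))\<^sup>2 / \<upsilon> n)"
proof -
  define B where "B = s *\<^sub>R (H ** dg \<upsilon> ** cjt H) + mat 1"
  have psd: "psd (s *\<^sub>R (H ** dg \<upsilon> ** cjt H))"
    using \<upsilon>(1) s by (intro psd_scaleR psd_conj psd_dg) auto
  have pd: "pd B" unfolding B_def by (rule pd_add_1[OF psd])
  \<comment> \<open>The form \<open>t\<close> is read in two ways: as the form of \<open>B\<close>
    at \<open>w\<close> it is at least \<open>s\<close> times the \<open>\<upsilon>\<close>-weighted
    square sum of \<open>g\<close>, and it is also the product of \<open>v\<close> with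
    \<open>g\<close>. The weighted inequality between geometric and arithmetic mean bounds
    \<open>2 * s * t\<close> by the claimed sum plus \<open>s * t\<close>.\<close>
  define w where "w = matrix_inv B *v (H *v v)"
  define g where "g = cjt H *v w"
  define t where "t = Re (hdot (H *v v) w)"
  have Bw: "B *v w = H *v v"
    by (simp add: w_def matrix_vector_mul_assoc pd_inv(1)[OF pd] matrix_mul_assoc)
  have "t = Re (hdot w (B *v w))"
    unfolding t_def Bw[symmetric] hdot_mult_vec using psd_hermitian[OF pd_psd[OF pd]] by simp
  also have "\<dots> = s * Re (hdot w ((H ** dg \<upsilon> ** cjt H) *v w)) + Re (hdot w w)"
    by (simp add: B_def matrix_vector_mult_add_rdistrib hdot_add_right scaleR_vec hdot_smult_right)
  also have "hdot w ((H ** dg \<upsilon> ** cjt H) *v w) = hdot g (dg \<upsilon> *v g)"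
    by (simp add: g_def hdot_mult_vec_left matrix_vector_mul_assoc matrix_mul_assoc)
  finally have "s * Re (hdot g (dg \<upsilon> *v g)) \<le> t"
    by (simp add: hdot_self)
  then have t_ge: "s * (\<Sum>n\<in>UNIV. \<upsilon> n * (cmod (g $ n))\<^sup>2) \<le> t"
    by (simp add: Re_hdot_dg)
  have "t = Re (hdot v g)"
    by (simp add: t_def g_def hdot_mult_vec)
  also have "\<dots> \<le> (\<Sum>n\<in>UNIV. cmod (v $ n) * cmod (g $ n))"
    unfolding hdot_def by (rule order_trans[OF complex_Re_le_cmod], rule order_trans[OF norm_sum]) (simp add: norm_mult)
  finally have "2 * s * t \<le> (\<Sum>n\<in>UNIV. 2 * s * (cmod (v $ n) * cmod (g $ n)))"
    using s by (simp flip: sum_distrib_left)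
  also have "\<dots> \<le> (\<Sum>n\<in>UNIV. (cmod (v $ n))\<^sup>2 / \<upsilon> n + s * (s * (\<upsilon> n * (cmod (g $ n))\<^sup>2)))"
  proof (rule sum_mono)
    fix n
    show "2 * s * (cmod (v $ n) * cmod (g $ n)) \<le> (cmod (v $ n))\<^sup>2 / \<upsilon> n + s * (s * (\<upsilon> n * (cmod (g $ n))\<^sup>2))"
    proof (cases "\<upsilon> n = 0")
      case True
      then show ?thesis by (simp add: \<upsilon>(2))
    next
      case False
      then have pos: "0 < \<upsilon> n" using \<upsilon>(1)[of n] by simp
      have "0 \<le> (cmod (v $ n) - s * \<upsilon> n * cmod (g $ n))\<^sup>2 / \<upsilon> n" using pos by simp
      also have "\<dots> = (cmod (v $ n))\<^sup>2 / \<upsilon> n + s * (s * (\<upsilon> n * (cmod (g $ n))\<^sup>2)) - 2 * s * (cmod (v $ n) * cmod (g $ n))"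
        using pos by (simp add: power2_eq_square field_simps)
      finally show ?thesis by simp
    qed
  qed
  also have "\<dots> = (\<Sum>n\<in>UNIV. (cmod (v $ n))\<^sup>2 / \<upsilon> n) + s * (s * (\<Sum>n\<in>UNIV. \<upsilon> n * (cmod (g $ n))\<^sup>2))"
    by (simp add: sum.distrib sum_distrib_left)
  also have "\<dots> \<le> (\<Sum>n\<in>UNIV. (cmod (v $ n))\<^sup>2 / \<upsilon> n) + s * t"
    using t_ge s by (intro add_left_mono mult_left_mono) auto
  finally show ?thesis by (simp add: t_def w_def B_def)
qed

lemma trace_gram_form:
  fixes W :: "complex^'t^'r"
  shows "trace (W ** cjt W ** K) = (\<Sum>k\<in>UNIV. hdot (column k W) (K *v column k W))"
proof -
  have "trace (W ** cjt W ** K) = trace (cjt W ** (K ** W))"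
    by (metis matrix_mul_assoc trace_mul_sym)
  also have "\<dots> = (\<Sum>k\<in>UNIV. hdot (column k W) (K *v column k W))"
    by (simp add: trace_def hdot_def matrix_matrix_mult_def matrix_vector_mult_def column_def)
  finally show ?thesis .
qed

text \<open>A factorization \<open>Q = V ** cjt V\<close> splits the trace over the columns of
  \<open>V\<close>; summing the vector bound over them reassembles the diagonal of \<open>Q\<close>.
  The result depends neither on \<open>H\<close> nor on \<open>s\<close>.\<close>

lemma trace_inv_bound:
  fixes H :: "complex^'t^'r"
  assumes Q: "psd Q" and \<upsilon>: "\<And>n. 0 \<le> \<upsilon> n" "\<And>n. \<upsilon> n = 0 \<Longrightarrow> Re (Q $ n $ n) = 0" and s: "0 < s"
  shows "Re (trace (s *\<^sub>R (H ** Q ** cjt H) ** matrix_inv (s *\<^sub>R (H ** dg \<upsilon> ** cjt H) + mat 1)))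
    \<le> (\<Sum>n\<in>UNIV. Re (Q $ n $ n) / \<upsilon> n)"
proof -
  obtain U d where U: "unitary U" "Q = U ** dg d ** cjt U" "\<And>i. 0 \<le> d i"
    using psd_spectral[OF Q] by blast
  define V where "V = U ** dg (\<lambda>i. sqrt (d i))"
  define K where "K = matrix_inv (s *\<^sub>R (H ** dg \<upsilon> ** cjt H) + mat 1)"
  have "V ** cjt V = U ** (dg (\<lambda>i. sqrt (d i)) ** dg (\<lambda>i. sqrt (d i))) ** cjt U"
    by (simp add: V_def matrix_mul_assoc)
  also have "\<dots> = Q" using U(3) by (simp add: U(2) dg_mult)
  finally have VV: "V ** cjt V = Q" .
  have Qnn: "Re (Q $ n $ n) = (\<Sum>k\<in>UNIV. (cmod (V $ n $ k))\<^sup>2)" for n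
  proof -
    have "Q $ n $ n = of_real (\<Sum>k\<in>UNIV. (cmod (V $ n $ k))\<^sup>2)"
      unfolding VV[symmetric] of_real_sum complex_norm_square
      by (simp add: matrix_matrix_mult_def)
    then show ?thesis by simp
  qed
  have V0: "V $ n $ k = 0" if "\<upsilon> n = 0" for n k
    using \<upsilon>(2)[OF that] by (simp add: Qnn sum_nonneg_eq_0_iff)
  define W where "W = H ** V"
  have "H ** Q ** cjt H = W ** cjt W"
    by (simp add: W_def VV[symmetric] matrix_mul_assoc)
  then have "Re (trace (s *\<^sub>R (H ** Q ** cjt H) ** K))
    = (\<Sum>k\<in>UNIV. s * Re (hdot (column k W) (K *v column k W)))"
    by (simp add: mult_scaleR_left trace_scaleR trace_gram_form sum_distrib_left)
  also have "\<dots> \<le> (\<Sum>k\<in>UNIV. \<Sum>n\<in>UNIV. (cmod (V $ n $ k))\<^sup>2 / \<upsilon> n)"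
  proof (rule sum_mono)
    fix k
    have "column k W = H *v column k V"
      by (simp add: W_def vec_eq_iff column_def matrix_matrix_mult_def matrix_vector_mult_def)
    then show "s * Re (hdot (column k W) (K *v column k W)) \<le> (\<Sum>n\<in>UNIV. (cmod (V $ n $ k))\<^sup>2 / \<upsilon> n)"
      using hdot_inv_bound[of \<upsilon> "column k V" s H] \<upsilon>(1) V0 s by (simp add: K_def column_def)
  qed
  also have "\<dots> = (\<Sum>n\<in>UNIV. \<Sum>k\<in>UNIV. (cmod (V $ n $ k))\<^sup>2 / \<upsilon> n)"
    by (rule sum.swap)
  also have "\<dots> = (\<Sum>n\<in>UNIV. Re (Q $ n $ n) / \<upsilon> n)"
    by (simp add: Qnn sum_divide_distrib)
  finally show ?thesis by (simp add: K_def)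
qed

subsection \<open>Continuity and the spectral norm\<close>

lemma frob_sq_eq_norm: "frob_sq A = (norm A)\<^sup>2"
  by (simp add: frob_sq_def norm_vec_def L2_set_def sum_nonneg)

lemma continuous_on_cjt [continuous_intros]:
  fixes f :: "'a::topological_space \<Rightarrow> complex^'n^'m"
  assumes "continuous_on S f"
  shows "continuous_on S (\<lambda>x. cjt (f x))"
  unfolding cjt_def by (intro continuous_on_vec_lambda continuous_on_cnj continuous_on_component assms)

lemma continuous_on_trace [continuous_intros]:
  fixes f :: "'a::topological_space \<Rightarrow> complex^'n^'n"
  assumes "continuous_on S f"
  shows "continuous_on S (\<lambda>x. trace (f x))"
  unfolding trace_def by (intro continuous_on_sum continuous_on_component assms)

text \<open>Cramer's rule turns every entry into a quotient of determinants. Continuity in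
  \<open>H\<close> is the source of measurability for rates and traces.\<close>

lemma continuous_on_matrix_inv:
  fixes f :: "'a::topological_space \<Rightarrow> complex^'n^'n"
  assumes f: "continuous_on S f" and pd: "\<And>x. x \<in> S \<Longrightarrow> pd (f x)"
  shows "continuous_on S (\<lambda>x. matrix_inv (f x))"
proof -
  have nz: "det (f x) \<noteq> 0" if "x \<in> S" for x using pd[OF that] by (simp add: pd_def)
  have entry: "matrix_inv (f x) $ k $ l
    = det (\<chi> i j. if j = k then axis l 1 $ i else f x $ i $ j) / det (f x)" if "x \<in> S" for x k l
  proof -
    have "f x *v column l (matrix_inv (f x)) = column l (f x ** matrix_inv (f x))"
      by (simp add: vec_eq_iff column_def matrix_matrix_mult_def matrix_vector_mult_def)
    also have "\<dots> = axis l 1"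
      by (simp add: pd_inv(1)[OF pd[OF that]] vec_eq_iff column_def mat_def axis_def)
    finally have "column l (matrix_inv (f x))
      = (\<chi> k. det (\<chi> i j. if j = k then axis l 1 $ i else f x $ i $ j) / det (f x))"
      by (simp add: cramer[OF nz[OF that]])
    then have "column l (matrix_inv (f x)) $ k
      = det (\<chi> i j. if j = k then axis l 1 $ i else f x $ i $ j) / det (f x)"
      by simp
    then show ?thesis by (simp add: column_def)
  qed
  have "continuous_on S (\<lambda>x. matrix_inv (f x) $ k $ l)" for k l
  proof -
    have "continuous_on S (\<lambda>x. (if j = k then axis l 1 $ i else f x $ i $ j))" for i j
      by (cases "j = k") (auto intro!: continuous_intros f)
    then have "continuous_on S (\<lambda>x. det (\<chi> i j. if j = k then axis l 1 $ i else f x $ i $ j) / det (f x))"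
      by (intro continuous_on_divide continuous_on_det continuous_on_vec_lambda f) (use nz in auto)
    then show ?thesis using entry continuous_on_cong[of S S] by (metis (no_types, lifting))
  qed
  then have "continuous_on S (\<lambda>x. \<chi> k l. matrix_inv (f x) $ k $ l)"
    by (intro continuous_on_vec_lambda)
  then show ?thesis by simp
qed

lemma continuous_on_ldet:
  fixes f g :: "'a::topological_space \<Rightarrow> complex^'n^'n"
  assumes "continuous_on S f" "continuous_on S g" "\<And>x. x \<in> S \<Longrightarrow> psd (f x)" "\<And>x. x \<in> S \<Longrightarrow> pd (g x)"
  shows "continuous_on S (\<lambda>x. ldet (f x) (g x))"
  unfolding ldet_def
proof (intro continuous_on_ln continuous_on_norm continuous_on_det continuous_intros continuous_on_matrix_inv assms ballI)
  fix x assume "x \<in> S"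
  then show "cmod (det (mat 1 + f x ** matrix_inv (g x))) \<noteq> 0"
    using ldet_nonneg(2)[OF assms(4,3), of x x] by auto
qed

lemma bounded_linear_mult_vec: "bounded_linear (\<lambda>x. H *v (x :: complex^'n))"
  for H :: "complex^'n^'m"
proof -
  have "linear (\<lambda>x. H *v x)"
    by (rule linearI) (simp_all add: vec.add matrix_vector_mult_def vec_eq_iff scaleR_sum_right distrib_left sum.distrib)
  then show ?thesis by (simp add: linear_conv_bounded_linear)
qed

lemma norm_mult_vec_le_spec: "norm (H *v x) \<le> spec_norm H * norm x"
  unfolding spec_norm_def by (rule onorm[OF bounded_linear_mult_vec])

lemma spec_norm_nonneg: "0 \<le> spec_norm H"
  unfolding spec_norm_def by (rule onorm_pos_le[OF bounded_linear_mult_vec])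

lemma norm_mult_vec_le: 
  fixes H :: "complex^'n^'m"
  shows "norm (H *v x) \<le> norm H * norm x"
proof -
  have "cmod ((H *v x) $ i) \<le> norm (H $ i) * norm x" for i
  proof -
    have "cmod ((H *v x) $ i) \<le> (\<Sum>j\<in>UNIV. \<bar>cmod (H $ i $ j)\<bar> * \<bar>cmod (x $ j)\<bar>)"
      unfolding matrix_vector_mult_def by (simp, rule order_trans[OF norm_sum]) (simp add: norm_mult)
    also have "\<dots> \<le> norm (H $ i) * norm x"
      unfolding norm_vec_def by (rule L2_set_mult_ineq)
    finally show ?thesis .
  qed
  then have "norm (H *v x) \<le> L2_set (\<lambda>i. norm x * norm (H $ i)) UNIV"
    unfolding norm_vec_def[of "H *v x"] by (intro L2_set_mono) (auto simp: mult.commute)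
  also have "\<dots> = norm x * norm H"
    unfolding norm_vec_def[of H] by (rule L2_set_right_distrib[symmetric]) simp
  finally show ?thesis by (simp add: mult.commute)
qed

lemma spec_norm_le_norm: "spec_norm H \<le> norm H"
  unfolding spec_norm_def by (rule onorm_bound) (auto simp: norm_mult_vec_le)

text \<open>It is 1-Lipschitz for the Frobenius norm, which is the \<open>norm\<close> of nested
  vectors.\<close>

lemma continuous_on_spec_norm: "continuous_on UNIV (spec_norm :: complex^'n^'m \<Rightarrow> real)"
proof -
  have le: "spec_norm A \<le> spec_norm B + norm (A - B)" for A B :: "complex^'n^'m"
  proof -
    have "(\<lambda>x. A *v x) = (\<lambda>x. B *v x + (A - B) *v x)"
      by (simp add: matrix_vector_mult_diff_rdistrib)
    then have "spec_norm A \<le> spec_norm B + spec_norm (A - B)"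
      unfolding spec_norm_def by (metis onorm_triangle bounded_linear_mult_vec)
    then show ?thesis using spec_norm_le_norm[of "A - B"] by simp
  qed
  have "dist (spec_norm A) (spec_norm B) \<le> dist A B" for A B :: "complex^'n^'m"
    using le[of A B] le[of B A] by (auto simp: dist_norm norm_minus_commute)
  then show ?thesis
    unfolding continuous_on_iff by (metis le_less_trans)
qed

text \<open>The operator bound says that the squared spectral norm times the identity dominates
  \<open>cjt H ** H\<close>; taking the trace against \<open>Q\<close> preserves this.\<close>

lemma trace_conj_le_spec:
  fixes H :: "complex^'t^'r"
  assumes "psd Q"
  shows "Re (trace (H ** Q ** cjt H)) \<le> (spec_norm H)\<^sup>2 * Re (trace Q)"
proof -
  have "psd ((spec_norm H)\<^sup>2 *\<^sub>R mat 1 - cjt H ** H)"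
    unfolding psd_iff
  proof (intro conjI allI)
    fix x
    have "hdot x ((cjt H ** H) *v x) = of_real ((norm (H *v x))\<^sup>2)"
      by (simp only: matrix_vector_mul_assoc[symmetric] hdot_mult_vec cjt_cjt hdot_self)
    then have "Re (hdot x (((spec_norm H)\<^sup>2 *\<^sub>R mat 1 - cjt H ** H) *v x))
      = (spec_norm H)\<^sup>2 * (norm x)\<^sup>2 - (norm (H *v x))\<^sup>2"
      by (simp add: matrix_vector_mult_diff_rdistrib hdot_diff_right scaleR_vec hdot_smult_right hdot_self flip: of_real_power of_real_mult)
    also have "\<dots> \<ge> 0"
      using power_mono[OF norm_mult_vec_le_spec[of H x] norm_ge_zero, of 2] by (simp add: power_mult_distrib)
    finally show "0 \<le> Re (hdot x (((spec_norm H)\<^sup>2 *\<^sub>R mat 1 - cjt H ** H) *v x))" .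
  qed simp
  from trace_psd_mult_nonneg[OF assms this]
  have "Re (trace (Q ** (cjt H ** H))) \<le> (spec_norm H)\<^sup>2 * Re (trace Q)"
    by (simp add: mult_diff_right trace_sub mult_scaleR_right trace_scaleR)
  also have "trace (Q ** (cjt H ** H)) = trace (H ** Q ** cjt H)"
    by (metis matrix_mul_assoc trace_mul_sym)
  finally show ?thesis .
qed

lemma spec_sq_le_frob: "(spec_norm H)\<^sup>2 \<le> frob_sq H"
  unfolding frob_sq_eq_norm by (intro power_mono spec_norm_le_norm spec_norm_nonneg)

subsection \<open>Covariances\<close>

definition cov :: "(complex^'t^'t) set" where
  "cov = {Q. psd Q \<and> trace Q = 1}"

text \<open>The total power is already replaced by 1, so the link to \<open>Upsilon\<close> is made
  for members of \<open>cov\<close>.\<close>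

definition ups :: "real \<Rightarrow> real \<Rightarrow> complex^'t^'t \<Rightarrow> 't \<Rightarrow> real" where
  "ups \<alpha> \<kappa> Q n = \<kappa>\<^sup>2 * ((1 - \<alpha>) * Re (Q $ n $ n) + \<alpha> / real CARD('t))"

definition nrate :: "real \<Rightarrow> real \<Rightarrow> real \<Rightarrow> complex^'t^'t \<Rightarrow> complex^'t^'r \<Rightarrow> real" where
  "nrate \<alpha> \<kappa> s Q H = ldet (s *\<^sub>R (H ** Q ** cjt H)) (s *\<^sub>R (H ** dg (ups \<alpha> \<kappa> Q) ** cjt H) + mat 1)"

lemma covD: "Q \<in> cov \<Longrightarrow> psd Q" "Q \<in> cov \<Longrightarrow> trace Q = 1"
  by (auto simp: cov_def)

lemma cov_diag:
  assumes "Q \<in> cov"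
  shows "0 \<le> Re (Q $ n $ n)" "(\<Sum>n\<in>UNIV. Re (Q $ n $ n)) = 1"
proof -
  show "0 \<le> Re (Q $ n $ n)" using psd_diag_nonneg covD(1)[OF assms] .
  have "Re (trace Q) = 1" using covD(2)[OF assms] by simp
  then show "(\<Sum>n\<in>UNIV. Re (Q $ n $ n)) = 1" by (simp add: trace_def)
qed

lemma Upsilon_eq_dg:
  assumes "Q \<in> cov"
  shows "Upsilon \<alpha> \<kappa> Q = dg (ups \<alpha> \<kappa> Q)"
  using cov_diag(2)[OF assms] by (simp add: Upsilon_def dg_def ups_def vec_eq_iff)

lemma rate_eq_nrate:
  assumes "Q \<in> cov"
  shows "rate \<alpha> \<kappa> s Q H = nrate \<alpha> \<kappa> s Q H / ln 2"
  by (simp add: rate_def nrate_def ldet_def log_def Upsilon_eq_dg[OF assms])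

lemma uniform_in_cov: "(1 / real CARD('t)) *\<^sub>R mat 1 \<in> (cov :: (complex^'t^'t) set)"
proof -
  have "trace ((1 / real CARD('t)) *\<^sub>R (mat 1 :: complex^'t^'t)) = 1"
    by (simp add: trace_scaleR trace_I scaleR_conv_of_real[where 'a=complex])
  then show ?thesis by (simp add: cov_def psd_scaleR psd_mat_1)
qed

lemma ups_uniform:
  "ups \<alpha> \<kappa> ((1 / real CARD('t)) *\<^sub>R mat 1 :: complex^'t^'t) n = \<kappa>\<^sup>2 / real CARD('t)"
  by (simp add: ups_def mat_def field_simps)

context
  fixes \<alpha> \<kappa> :: real
  assumes \<alpha>: "0 \<le> \<alpha>" "\<alpha> \<le> 1" and \<kappa>: "0 < \<kappa>"
begin

lemma ups_nonneg: "Q \<in> cov \<Longrightarrow> 0 \<le> ups \<alpha> \<kappa> Q n"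
  unfolding ups_def using \<alpha> cov_diag(1)[of Q n] by (intro mult_nonneg_nonneg add_nonneg_nonneg) auto

text \<open>Both summands are nonnegative and the second vanishes only for
  \<open>\<alpha> = 0\<close>; an antenna without distortion therefore sends no power. This meets
  the degenerate case of \<open>trace_inv_bound\<close>.\<close>

lemma ups_eq_0:
  fixes Q :: "complex^'t^'t"
  assumes "Q \<in> cov" "ups \<alpha> \<kappa> Q n = 0"
  shows "Re (Q $ n $ n) = 0"
proof -
  have "(1 - \<alpha>) * Re (Q $ n $ n) + \<alpha> / real CARD('t) = 0"
    using assms(2) \<kappa> by (simp add: ups_def)
  moreover have "0 \<le> (1 - \<alpha>) * Re (Q $ n $ n)" "0 \<le> \<alpha> / real CARD('t)"
    using \<alpha> cov_diag(1)[OF assms(1)] by auto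
  ultimately have "(1 - \<alpha>) * Re (Q $ n $ n) = 0" "\<alpha> / real CARD('t) = 0" by linarith+
  then show ?thesis by auto
qed

lemma nrate_psd:
  assumes "Q \<in> cov" "0 \<le> s"
  shows "psd (s *\<^sub>R (H ** Q ** cjt H))" "psd (H ** dg (ups \<alpha> \<kappa> Q) ** cjt H)"
    "pd (s *\<^sub>R (H ** dg (ups \<alpha> \<kappa> Q) ** cjt H) + mat 1)"
  using assms by (auto intro!: psd_scaleR psd_conj psd_dg pd_add_1 ups_nonneg dest: covD)

lemma nrate_nonneg: "Q \<in> cov \<Longrightarrow> 0 \<le> s \<Longrightarrow> 0 \<le> nrate \<alpha> \<kappa> s Q H"
  unfolding nrate_def by (intro ldet_nonneg nrate_psd)

lemma nrate_le_trace:
  assumes "Q \<in> cov" "0 \<le> s"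
  shows "nrate \<alpha> \<kappa> s Q H \<le> s * Re (trace (H ** Q ** cjt H))"
proof -
  have "nrate \<alpha> \<kappa> s Q H \<le> Re (trace (s *\<^sub>R (H ** Q ** cjt H) ** matrix_inv (s *\<^sub>R (H ** dg (ups \<alpha> \<kappa> Q) ** cjt H) + mat 1)))"
    unfolding nrate_def by (intro ldet_le_trace nrate_psd assms)
  also have "\<dots> \<le> Re (trace (s *\<^sub>R (H ** Q ** cjt H)))"
    using assms by (intro trace_mult_inv_le nrate_psd)
  finally show ?thesis by (simp add: trace_scaleR)
qed

lemma nrate_mono:
  assumes "Q \<in> cov" "0 < s" "s \<le> t"
  shows "nrate \<alpha> \<kappa> s Q H \<le> nrate \<alpha> \<kappa> t Q H"
  unfolding nrate_def
  using assms by (intro ldet_scale_mono nrate_psd psd_conj covD) auto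

text \<open>The tangent at \<open>q = u\<close> of the concave function \<open>q / ((1 - \<alpha>) q + \<alpha> u)\<close>, multiplied by \<open>u\<close>.\<close>

lemma distortion_tangent:
  fixes q u :: real
  assumes "0 \<le> q" "0 \<le> u"
  shows "q / (\<kappa>\<^sup>2 * ((1 - \<alpha>) * q + \<alpha> * u)) * u \<le> ((1 - \<alpha>) * u + \<alpha> * q) / \<kappa>\<^sup>2"
proof (cases "(1 - \<alpha>) * q + \<alpha> * u = 0")
  case True
  then show ?thesis using assms \<alpha> by simp
next
  case False
  then have pos: "0 < (1 - \<alpha>) * q + \<alpha> * u"
    using assms \<alpha> by (simp add: order.not_eq_order_implies_strict)
  have "((1 - \<alpha>) * u + \<alpha> * q) * ((1 - \<alpha>) * q + \<alpha> * u) - q * u = \<alpha> * (1 - \<alpha>) * (q - u)\<^sup>2"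
    by (simp add: power2_eq_square algebra_simps)
  also have "\<dots> \<ge> 0" using \<alpha> by simp
  finally have "q * u / ((1 - \<alpha>) * q + \<alpha> * u) \<le> (1 - \<alpha>) * u + \<alpha> * q"
    using pos by (simp add: pos_divide_le_eq)
  then have "q * u / ((1 - \<alpha>) * q + \<alpha> * u) / \<kappa>\<^sup>2 \<le> ((1 - \<alpha>) * u + \<alpha> * q) / \<kappa>\<^sup>2"
    by (intro divide_right_mono) auto
  then show ?thesis by (simp add: mult_ac)
qed

text \<open>Each term is replaced by its tangent at the uniform power \<open>1 / CARD('t)\<close>.
  The tangents are affine and the powers sum to 1, so the total is the value at the uniform
  covariance.\<close>

lemma sum_ratio_ups_le:
  fixes Q :: "complex^'t^'t"
  assumes "Q \<in> cov"
  shows "(\<Sum>n\<in>UNIV. Re (Q $ n $ n) / ups \<alpha> \<kappa> Q n) \<le> real CARD('t) / \<kappa>\<^sup>2"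
proof -
  let ?u = "1 / real CARD('t)"
  have "(\<Sum>n\<in>UNIV. Re (Q $ n $ n) / ups \<alpha> \<kappa> Q n) * ?u
    \<le> (\<Sum>n\<in>UNIV. ((1 - \<alpha>) * ?u + \<alpha> * Re (Q $ n $ n)) / \<kappa>\<^sup>2)"
    unfolding sum_distrib_right
    using distortion_tangent[OF cov_diag(1)[OF assms], of ?u]
    by (intro sum_mono) (simp add: ups_def)
  also have "\<dots> = (\<Sum>n\<in>UNIV. (1 - \<alpha>) * ?u + \<alpha> * Re (Q $ n $ n)) / \<kappa>\<^sup>2"
    by (simp only: sum_divide_distrib)
  also have "(\<Sum>n\<in>UNIV. (1 - \<alpha>) * ?u + \<alpha> * Re (Q $ n $ n)) = 1"
    by (simp add: sum.distrib sum_distrib_left[symmetric] cov_diag(2)[OF assms])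
  finally show ?thesis by (simp add: field_simps)
qed

lemma nrate_le_bound:
  fixes H :: "complex^'t^'r"
  assumes "Q \<in> cov" "0 < s"
  defines "m \<equiv> min CARD('t) CARD('r)"
  shows "nrate \<alpha> \<kappa> s Q H \<le> real m * ln (1 + real CARD('t) / (real m * \<kappa>\<^sup>2))"
proof -
  have "rank (s *\<^sub>R (H ** Q ** cjt H)) \<le> rank H"
  proof -
    have "s *\<^sub>R (H ** Q ** cjt H) = H ** (s *\<^sub>R (Q ** cjt H))"
      by (simp add: mult_scaleR_right matrix_mul_assoc)
    then show ?thesis by (simp only: rank_mult_le_left)
  qed
  then have rank: "rank (s *\<^sub>R (H ** Q ** cjt H)) \<le> m"
    using rank_le_dims[of H] by (simp add: m_def)
  have tr: "Re (trace (s *\<^sub>R (H ** Q ** cjt H) ** matrix_inv (s *\<^sub>R (H ** dg (ups \<alpha> \<kappa> Q) ** cjt H) + mat 1)))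
    \<le> real CARD('t) / \<kappa>\<^sup>2"
    by (rule order_trans[OF trace_inv_bound sum_ratio_ups_le])
       (use assms ups_nonneg ups_eq_0 covD in auto)
  have "0 < m" by (simp add: m_def)
  then have "nrate \<alpha> \<kappa> s Q H \<le> real m * ln (1 + (real CARD('t) / \<kappa>\<^sup>2) / real m)"
    unfolding nrate_def using assms by (intro ldet_le_rank nrate_psd rank tr) auto
  then show ?thesis by (simp add: mult.commute)
qed

lemma continuous_on_nrate:
  assumes "Q \<in> cov" "0 \<le> s"
  shows "continuous_on UNIV (nrate \<alpha> \<kappa> s Q)"
  unfolding nrate_def[abs_def]
  by (intro continuous_on_ldet continuous_intros nrate_psd assms)

lemma nrate_div_limit:
  assumes "Q \<in> cov"
  shows "((\<lambda>s. nrate \<alpha> \<kappa> s Q H / s) \<longlongrightarrow> Re (trace (H ** Q ** cjt H))) (at_right 0)"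
  unfolding nrate_def
  by (intro ldet_div_limit nrate_psd psd_conj covD assms) (rule order_refl)

text \<open>On eigenvalues this is the tangent of \<open>x / (\<kappa>\<^sup>2 (1 - \<alpha>) x + 1)\<close> at \<open>x = 1 / (\<kappa>\<^sup>2 \<alpha>)\<close>;
  written without that quotient, it stays valid for \<open>\<alpha> = 0\<close>.\<close>

lemma trace_diag_inv_le:
  fixes A Y :: "complex^'n^'n"
  assumes "psd A" "pd Y"
  shows "Re (trace (A ** matrix_inv ((\<kappa>\<^sup>2 * (1 - \<alpha>)) *\<^sub>R A + Y)))
    \<le> real CARD('n) * (1 - \<alpha>) / \<kappa>\<^sup>2 + \<alpha>\<^sup>2 * Re (trace (A ** matrix_inv Y))"
proof -
  define c where "c = \<kappa>\<^sup>2 * (1 - \<alpha>)"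
  have c: "0 \<le> c" using \<alpha> by (simp add: c_def)
  obtain S T :: "complex^'n^'n" and x where S: "S ** T = mat 1" "T ** S = mat 1"
    "Y = S ** cjt S" "A = S ** dg x ** cjt S" "\<And>i. 0 \<le> x i"
    using simultaneous_diag[OF assms(2,1)] by blast
  have pos: "0 < c * x i + 1" for i using S(5)[of i] c by (simp add: add_nonneg_pos)
  have cS: "cjt S ** cjt T = mat 1" using S(2) by (metis cjt_mat_1 cjt_mult)
  have "S ** dg (\<lambda>i. c * x i + 1) ** cjt S = S ** (c *\<^sub>R dg x + mat 1) ** cjt S"
    by (simp add: dg_1[symmetric] dg_scaleR dg_add)
  then have cAY: "c *\<^sub>R A + Y = S ** dg (\<lambda>i. c * x i + 1) ** cjt S"
    by (simp add: S(3,4) mult_add_left mult_add_right mult_scaleR_left mult_scaleR_right)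
  have "(c *\<^sub>R A + Y) ** (cjt T ** dg (\<lambda>i. 1 / (c * x i + 1)) ** T) =
    S ** dg (\<lambda>i. c * x i + 1) ** (cjt S ** cjt T) ** dg (\<lambda>i. 1 / (c * x i + 1)) ** T"
    by (simp add: cAY matrix_mul_assoc)
  also have "\<dots> = S ** (dg (\<lambda>i. c * x i + 1) ** dg (\<lambda>i. 1 / (c * x i + 1))) ** T"
    by (simp add: cS matrix_mul_assoc)
  also have "\<dots> = mat 1"
    using pos by (simp add: dg_mult dg_1 S(1) less_imp_neq[THEN not_sym])
  finally have inv: "matrix_inv (c *\<^sub>R A + Y) = cjt T ** dg (\<lambda>i. 1 / (c * x i + 1)) ** T"
    by (rule matrix_inv_eqI)
  have "A ** matrix_inv (c *\<^sub>R A + Y) = S ** dg x ** (cjt S ** cjt T) ** dg (\<lambda>i. 1 / (c * x i + 1)) ** T"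
    unfolding inv by (simp add: S(4) matrix_mul_assoc)
  also have "\<dots> = S ** (dg x ** dg (\<lambda>i. 1 / (c * x i + 1))) ** T"
    by (simp add: cS matrix_mul_assoc)
  finally have "Re (trace (A ** matrix_inv (c *\<^sub>R A + Y))) = (\<Sum>i\<in>UNIV. x i / (c * x i + 1))"
    by (simp add: trace_similar[OF S(2)] dg_mult trace_dg)
  also have "\<dots> \<le> (\<Sum>i\<in>(UNIV::'n set). (1 - \<alpha>) / \<kappa>\<^sup>2 + \<alpha>\<^sup>2 * x i)"
  proof (rule sum_mono)
    fix i
    have "((1 - \<alpha>) / \<kappa>\<^sup>2 + \<alpha>\<^sup>2 * x i) * (c * x i + 1) - x i = (1 - \<alpha>) / \<kappa>\<^sup>2 * (1 - \<alpha> * \<kappa>\<^sup>2 * x i)\<^sup>2"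
      using \<kappa> by (simp add: c_def power2_eq_square field_simps)
    also have "\<dots> \<ge> 0" using \<alpha> by simp
    finally show "x i / (c * x i + 1) \<le> (1 - \<alpha>) / \<kappa>\<^sup>2 + \<alpha>\<^sup>2 * x i"
      using pos[of i] by (simp add: pos_divide_le_eq)
  qed
  also have "\<dots> = real CARD('n) * (1 - \<alpha>) / \<kappa>\<^sup>2 + \<alpha>\<^sup>2 * (\<Sum>i\<in>UNIV. x i)"
    by (simp add: sum.distrib sum_distrib_left)
  also have "(\<Sum>i\<in>UNIV. x i) = Re (trace (A ** matrix_inv Y))"
    unfolding S(3,4) simultaneous_diag_trace[OF S(1,2)] by simp
  finally show ?thesis by (simp add: c_def)
qed

end

subsection \<open>Channels\<close>

definition sign_flip :: "'t \<Rightarrow> complex^'t^'t" where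
  "sign_flip k = dg (\<lambda>i. if i = k then -1 else 1)"

definition swap_mat :: "'t \<Rightarrow> 't \<Rightarrow> complex^'t^'t" where
  "swap_mat a b = (\<chi> i j. if i = Transposition.transpose a b j then 1 else 0)"

lemma cjt_sign_flip [simp]: "cjt (sign_flip k) = sign_flip k"
  by (simp add: sign_flip_def)

lemma unitary_sign_flip: "unitary (sign_flip k)"
proof -
  have "sign_flip k ** sign_flip k = dg (\<lambda>i. 1)"
    unfolding sign_flip_def dg_mult by (rule arg_cong[of _ _ dg]) auto
  then show ?thesis by (simp add: unitary_def dg_1)
qed

lemma sign_flip_conj_nth:
  "(sign_flip k ** W ** sign_flip k) $ i $ j
    = (if i = k then -1 else 1) * (if j = k then -1 else 1) * W $ i $ j"
  by (simp add: sign_flip_def mult_dg_nth dg_mult_nth)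

text \<open>Diagonal matrices commute with sign flips, so a flip of the channel leaves its
  distortion covariance unchanged; a swap would permute \<open>d\<close>.\<close>

lemma sign_flip_conj_dg: "sign_flip k ** dg d ** sign_flip k = dg d"
  by (simp add: vec_eq_iff sign_flip_conj_nth) (simp add: dg_def)

lemma mult_swap_nth: "(W ** swap_mat a b) $ i $ j = W $ i $ Transposition.transpose a b j"
  by (simp add: matrix_matrix_mult_def swap_mat_def if_distrib cong: if_cong)

lemma swap_mult_nth: "(cjt (swap_mat a b) ** W) $ i $ j = W $ Transposition.transpose a b i $ j"
  by (simp add: matrix_matrix_mult_def swap_mat_def if_distrib[of cnj] if_distrib[of "\<lambda>z. z * _"] cong: if_cong)

lemma unitary_swap: "unitary (swap_mat a b)"
proof -
  have inj: "Transposition.transpose a b i = Transposition.transpose a b j \<longleftrightarrow> i = j" for i j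
    by (metis transpose_involutory)
  have "cjt (swap_mat a b) ** swap_mat a b = mat 1"
    by (simp add: vec_eq_iff swap_mult_nth) (simp add: swap_mat_def mat_def inj)
  then show ?thesis
    unfolding unitary_def using matrix_left_right_inverse by blast
qed

text \<open>Interpreted twice in the end: for the given channel and for the single-antenna one, with
  the same \<open>\<alpha>\<close> and \<open>\<kappa>\<close>.\<close>

locale impaired_channel =
  fixes M :: "(complex^'t^'r) measure" and \<alpha> \<kappa> :: real
  assumes channel: "channel M" and \<alpha>: "0 \<le> \<alpha>" "\<alpha> \<le> 1" and \<kappa>: "0 < \<kappa>"
begin

sublocale prob_space M
  using channel by (simp add: channel_def)

lemma sets_M: "sets M = sets borel"
  using channel by (simp add: channel_def)

lemma continuous_measurable: "continuous_on UNIV f \<Longrightarrow> f \<in> borel_measurable M"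
  using borel_measurable_continuous_onI measurable_cong_sets[OF sets_M refl] by blast

lemma integrable_frob_sq: "integrable M frob_sq"
  using channel by (simp add: channel_def)

lemma integral_frob_sq: "(\<integral>H. frob_sq H \<partial>M) = real CARD('t) * real CARD('r)"
  using channel by (simp add: channel_def)

lemma AE_rank: "AE H in M. rank H = min CARD('t) CARD('r)"
  using channel by (simp add: channel_def)

text \<open>The second moment is the integrability that a channel provides, so
  \<open>frob_sq\<close> is the majorant for spectral norms, traces and matrix entries
  alike.\<close>

lemma frob_dominated_integrable:
  fixes f :: "complex^'t^'r \<Rightarrow> 'b::{banach, second_countable_topology}"
  assumes "continuous_on UNIV f" "\<And>H. norm (f H) \<le> frob_sq H"
  shows "integrable M f"
  by (rule Bochner_Integration.integrable_bound[OF integrable_frob_sq])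
     (use assms continuous_measurable in \<open>auto intro!: AE_I2 order_trans[OF assms(2)]\<close>)

lemma integrable_spec_sq: "integrable M (\<lambda>H. (spec_norm H)\<^sup>2)"
  by (rule frob_dominated_integrable)
     (auto intro!: continuous_intros continuous_on_spec_norm spec_sq_le_frob)

lemma nrate_bound: "Q \<in> cov \<Longrightarrow> 0 < s \<Longrightarrow> nrate \<alpha> \<kappa> s Q (H::complex^'t^'r) \<le> real (min CARD('t) CARD('r)) * ln (1 + real CARD('t) / (real (min CARD('t) CARD('r)) * \<kappa>\<^sup>2))"
  by (rule nrate_le_bound[OF \<alpha> \<kappa>])

lemma integrable_nrate: "Q \<in> cov \<Longrightarrow> 0 < s \<Longrightarrow> integrable M (nrate \<alpha> \<kappa> s Q)"
  by (rule integrable_const_bound[of _ "real (min CARD('t) CARD('r)) * ln (1 + real CARD('t) / (real (min CARD('t) CARD('r)) * \<kappa>\<^sup>2))"])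
     (auto intro!: AE_I2 nrate_bound continuous_measurable continuous_on_nrate[OF \<alpha> \<kappa>]
       simp: nrate_nonneg[OF \<alpha> \<kappa>])

lemma integral_nrate_le: "Q \<in> cov \<Longrightarrow> 0 < s \<Longrightarrow>
    (\<integral>H. nrate \<alpha> \<kappa> s Q H \<partial>M) \<le> real (min CARD('t) CARD('r)) * ln (1 + real CARD('t) / (real (min CARD('t) CARD('r)) * \<kappa>\<^sup>2))"
  by (intro integral_le_const integrable_nrate AE_I2 nrate_bound)

lemma capacity_eq: "capacity \<alpha> \<kappa> M s = (SUP Q\<in>cov. (\<integral>H. nrate \<alpha> \<kappa> s Q H \<partial>M) / ln 2)"
  unfolding capacity_def cov_def[symmetric]
proof (rule SUP_cong[OF refl])
  fix Q :: "complex^'t^'t" assume "Q \<in> cov"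
  then have "(\<integral>H. rate \<alpha> \<kappa> s Q H \<partial>M) = (\<integral>H. nrate \<alpha> \<kappa> s Q H / ln 2 \<partial>M)"
    by (intro Bochner_Integration.integral_cong refl rate_eq_nrate)
  then show "(\<integral>H. rate \<alpha> \<kappa> s Q H \<partial>M) = (\<integral>H. nrate \<alpha> \<kappa> s Q H \<partial>M) / ln 2"
    by simp
qed

lemma cov_nonempty: "(cov :: (complex^'t^'t) set) \<noteq> {}"
  using uniform_in_cov by blast

lemma capacity_le:
  assumes "\<And>Q. Q \<in> cov \<Longrightarrow> (\<integral>H. nrate \<alpha> \<kappa> s Q H \<partial>M) \<le> c"
  shows "capacity \<alpha> \<kappa> M s \<le> c / ln 2"
  unfolding capacity_eq
  by (rule cSUP_least[OF cov_nonempty]) (simp add: assms divide_right_mono)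

text \<open>A supremum of reals is an upper bound only over a bounded set; boundedness holds because
  distortion caps the rate uniformly in \<open>Q\<close> and \<open>H\<close>.\<close>

lemma capacity_ge:
  assumes "0 < s" "Q \<in> cov"
  shows "(\<integral>H. nrate \<alpha> \<kappa> s Q H \<partial>M) / ln 2 \<le> capacity \<alpha> \<kappa> M s"
  unfolding capacity_eq
proof (rule cSUP_upper[OF assms(2)], rule bdd_aboveI2)
  fix Q :: "complex^'t^'t" assume "Q \<in> cov"
  then show "(\<integral>H. nrate \<alpha> \<kappa> s Q H \<partial>M) / ln 2 \<le> real (min CARD('t) CARD('r)) * ln (1 + real CARD('t) / (real (min CARD('t) CARD('r)) * \<kappa>\<^sup>2)) / ln 2"
    using integral_nrate_le[OF _ assms(1)] by (simp add: divide_right_mono)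
qed

lemma capacity_le_bound: "0 < s \<Longrightarrow> capacity \<alpha> \<kappa> M s \<le> real (min CARD('t) CARD('r)) * ln (1 + real CARD('t) / (real (min CARD('t) CARD('r)) * \<kappa>\<^sup>2)) / ln 2"
  by (intro capacity_le integral_nrate_le)

lemma capacity_mono:
  assumes "0 < s" "s \<le> t"
  shows "capacity \<alpha> \<kappa> M s \<le> capacity \<alpha> \<kappa> M t"
  unfolding capacity_eq[of s]
proof (rule cSUP_least[OF cov_nonempty])
  fix Q :: "complex^'t^'t" assume Q: "Q \<in> cov"
  have "(\<integral>H. nrate \<alpha> \<kappa> s Q H \<partial>M) \<le> (\<integral>H. nrate \<alpha> \<kappa> t Q H \<partial>M)"
    using Q assms by (intro integral_mono integrable_nrate nrate_mono[OF \<alpha> \<kappa>]) auto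
  then have "(\<integral>H. nrate \<alpha> \<kappa> s Q H \<partial>M) / ln 2 \<le> (\<integral>H. nrate \<alpha> \<kappa> t Q H \<partial>M) / ln 2"
    by (simp add: divide_right_mono)
  also have "\<dots> \<le> capacity \<alpha> \<kappa> M t" using Q assms by (intro capacity_ge) auto
  finally show "(\<integral>H. nrate \<alpha> \<kappa> s Q H \<partial>M) / ln 2 \<le> capacity \<alpha> \<kappa> M t" .
qed

subsection \<open>Low signal-to-noise ratio\<close>

text \<open>Mean received signal power at unit SNR under input covariance \<open>Q\<close>.\<close>

definition gain :: "complex^'t^'t \<Rightarrow> real" where
  "gain Q = (\<integral>H. Re (trace (H ** Q ** cjt H)) \<partial>M)"

definition low_slope :: real where
  "low_slope = (SUP Q\<in>cov. gain Q)"

lemma trace_conj_nonneg: "Q \<in> cov \<Longrightarrow> 0 \<le> Re (trace (H ** Q ** cjt H))"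
  by (intro psd_trace_nonneg psd_conj covD)

lemma trace_conj_le: "Q \<in> cov \<Longrightarrow> Re (trace (H ** Q ** cjt H)) \<le> (spec_norm H)\<^sup>2"
  using trace_conj_le_spec[of Q H] covD by fastforce

lemma continuous_on_trace_conj: "continuous_on UNIV (\<lambda>H. Re (trace (H ** Q ** cjt H)))"
  by (intro continuous_intros)

lemma integrable_trace_conj:
  assumes "Q \<in> cov"
  shows "integrable M (\<lambda>H. Re (trace (H ** Q ** cjt H)))"
proof (rule frob_dominated_integrable[OF continuous_on_trace_conj])
  fix H :: "complex^'t^'r"
  show "norm (Re (trace (H ** Q ** cjt H))) \<le> frob_sq H"
    using trace_conj_nonneg[OF assms, of H] order_trans[OF trace_conj_le[OF assms] spec_sq_le_frob, of H]
    by simp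
qed

lemma gain_le_spec: "Q \<in> cov \<Longrightarrow> gain Q \<le> (\<integral>H. (spec_norm H)\<^sup>2 \<partial>M)"
  unfolding gain_def by (intro integral_mono integrable_trace_conj integrable_spec_sq trace_conj_le)

lemma gain_le_low_slope: "Q \<in> cov \<Longrightarrow> gain Q \<le> low_slope"
  unfolding low_slope_def by (rule cSUP_upper) (auto intro!: bdd_aboveI2 gain_le_spec)

lemma low_slope_le: "(\<And>Q. Q \<in> cov \<Longrightarrow> gain Q \<le> c) \<Longrightarrow> low_slope \<le> c"
  unfolding low_slope_def by (rule cSUP_least[OF cov_nonempty])

lemma low_slope_le_spec: "low_slope \<le> (\<integral>H. (spec_norm H)\<^sup>2 \<partial>M)"
  by (intro low_slope_le gain_le_spec)

lemma gain_uniform: "gain ((1 / real CARD('t)) *\<^sub>R mat 1) = (\<integral>H. frob_sq H \<partial>M) / real CARD('t)"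
  unfolding gain_def
  by (simp add: mult_scaleR_left mult_scaleR_right trace_scaleR trace_mult_cjt)

lemma low_slope_ge_frob: "(\<integral>H. frob_sq H \<partial>M) / real CARD('t) \<le> low_slope"
  using gain_le_low_slope[OF uniform_in_cov] by (simp add: gain_uniform)

lemma integral_nrate_le_gain:
  assumes "Q \<in> cov" "0 < s"
  shows "(\<integral>H. nrate \<alpha> \<kappa> s Q H \<partial>M) \<le> s * gain Q"
proof -
  have "(\<integral>H. nrate \<alpha> \<kappa> s Q H \<partial>M) \<le> (\<integral>H. s * Re (trace (H ** Q ** cjt H)) \<partial>M)"
    using assms by (intro integral_mono integrable_nrate integrable_mult_right integrable_trace_conj
        nrate_le_trace[OF \<alpha> \<kappa>]) auto
  then show ?thesis by (simp add: gain_def)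
qed

text \<open>The quotient of rate and SNR never exceeds the received power, hence
  \<open>frob_sq\<close> dominates it. Putting \<open>s = inverse t\<close> moves the limit to
  \<open>at_top\<close>, where dominated convergence is applied.\<close>

lemma integral_nrate_div_limit:
  assumes Q: "Q \<in> cov"
  shows "((\<lambda>s. (\<integral>H. nrate \<alpha> \<kappa> s Q H \<partial>M) / s) \<longlongrightarrow> gain Q) (at_right 0)"
proof -
  \<comment> \<open>Dominated convergence wants measurability for all \<open>t\<close>; for \<open>t \<le> 0\<close> the noise covariance
    may be singular.\<close>
  define f :: "real \<Rightarrow> complex^'t^'r \<Rightarrow> real" where "f = (\<lambda>t H. if 0 < t then nrate \<alpha> \<kappa> (inverse t) Q H / inverse t else (0::real))"
  have "((\<lambda>t. \<integral>H. f t H \<partial>M) \<longlongrightarrow> gain Q) at_top"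
    unfolding gain_def
  proof (rule integral_dominated_convergence_at_top[where w = frob_sq])
    show "f t \<in> borel_measurable M" for t
    proof (cases "0 < t")
      case True
      have "nrate \<alpha> \<kappa> (inverse t) Q \<in> borel_measurable M"
        using True by (intro continuous_measurable continuous_on_nrate[OF \<alpha> \<kappa>] Q) auto
      then show ?thesis using True by (simp add: f_def)
    qed (simp add: f_def)
    show "AE H in M. ((\<lambda>t. f t H) \<longlongrightarrow> Re (trace (H ** Q ** cjt H))) at_top"
    proof (rule AE_I2)
      fix H :: "complex^'t^'r"
      have "((\<lambda>t. nrate \<alpha> \<kappa> (inverse t) Q H / inverse t) \<longlongrightarrow> Re (trace (H ** Q ** cjt H))) at_top"
        using nrate_div_limit[OF \<alpha> \<kappa> Q, of H] by (simp only: filterlim_at_right_to_top)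
      then show "((\<lambda>t. f t H) \<longlongrightarrow> Re (trace (H ** Q ** cjt H))) at_top"
        by (rule Lim_transform_eventually)
           (auto intro!: eventually_mono[OF eventually_gt_at_top[of 0]] simp: f_def)
    qed
    show "\<forall>\<^sub>F t in at_top. AE H in M. norm (f t H) \<le> frob_sq H"
      using eventually_gt_at_top[of 0]
    proof (rule eventually_mono, intro AE_I2)
      fix t :: real and H :: "complex^'t^'r" assume t: "0 < t"
      have "f t H \<le> Re (trace (H ** Q ** cjt H))"
        using t nrate_le_trace[OF \<alpha> \<kappa> Q, of "inverse t" H] by (simp add: f_def divide_simps)
      also have "\<dots> \<le> frob_sq H" using trace_conj_le[OF Q] spec_sq_le_frob order_trans by blast
      finally show "norm (f t H) \<le> frob_sq H"
        using t nrate_nonneg[OF \<alpha> \<kappa> Q, of "inverse t" H] by (simp add: f_def)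
    qed
  qed (auto intro: integrable_frob_sq continuous_measurable continuous_on_trace_conj)
  then have "((\<lambda>t. (\<integral>H. nrate \<alpha> \<kappa> (inverse t) Q H \<partial>M) / inverse t) \<longlongrightarrow> gain Q) at_top"
    by (rule Lim_transform_eventually)
       (auto intro!: eventually_mono[OF eventually_gt_at_top[of 0]] simp: f_def)
  then show ?thesis by (simp only: filterlim_at_right_to_top)
qed

text \<open>The quotient approaches its limit from below: it never exceeds the slope, and any
  smaller value \<open>y\<close> is eventually beaten by one nearly optimal covariance.\<close>

lemma capacity_div_limit: "((\<lambda>s. capacity \<alpha> \<kappa> M s / s) \<longlongrightarrow> low_slope / ln 2) (at_right 0)"
proof (rule increasing_tendsto)
  show "\<forall>\<^sub>F s in at_right 0. capacity \<alpha> \<kappa> M s / s \<le> low_slope / ln 2"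
    using eventually_at_right_less
  proof (rule eventually_mono)
    fix s :: real assume s: "0 < s"
    have "capacity \<alpha> \<kappa> M s \<le> (s * low_slope) / ln 2"
    proof (rule capacity_le)
      fix Q :: "complex^'t^'t" assume Q: "Q \<in> cov"
      have "s * gain Q \<le> s * low_slope" using s gain_le_low_slope[OF Q] by simp
      with integral_nrate_le_gain[OF Q s] show "(\<integral>H. nrate \<alpha> \<kappa> s Q H \<partial>M) \<le> s * low_slope" by simp
    qed
    then show "capacity \<alpha> \<kappa> M s / s \<le> low_slope / ln 2" using s by (simp add: field_simps)
  qed
  fix y assume "y < low_slope / ln 2"
  then have "y * ln 2 < low_slope" by (simp add: field_simps)
  then obtain Q where Q: "Q \<in> cov" "y * ln 2 < gain Q"
    unfolding low_slope_def
    by (subst (asm) less_cSUP_iff) (auto intro!: cov_nonempty bdd_aboveI2 gain_le_spec)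
  have "\<forall>\<^sub>F s in at_right 0. y * ln 2 < (\<integral>H. nrate \<alpha> \<kappa> s Q H \<partial>M) / s"
    using order_tendstoD(1)[OF integral_nrate_div_limit[OF Q(1)] Q(2)] .
  then show "\<forall>\<^sub>F s in at_right 0. y < capacity \<alpha> \<kappa> M s / s"
    using eventually_at_right_less
  proof eventually_elim
    case (elim s)
    have "y < (\<integral>H. nrate \<alpha> \<kappa> s Q H \<partial>M) / ln 2 / s"
      using elim by (simp add: pos_less_divide_eq field_simps)
    also have "\<dots> \<le> capacity \<alpha> \<kappa> M s / s"
      using elim(2) by (intro divide_right_mono capacity_ge Q(1)) auto
    finally show ?case .
  qed
qed

subsection \<open>High signal-to-noise ratio\<close>

lemma capacity_limit_exists: "\<exists>L. ((\<lambda>s. capacity \<alpha> \<kappa> M s) \<longlongrightarrow> L) at_top"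
proof -
  have bdd: "bdd_above (capacity \<alpha> \<kappa> M ` {0<..})"
    by (rule bdd_aboveI2) (auto intro: capacity_le_bound)
  have "((\<lambda>s. capacity \<alpha> \<kappa> M s) \<longlongrightarrow> (SUP s\<in>{0<..}. capacity \<alpha> \<kappa> M s)) at_top"
  proof (rule increasing_tendsto)
    show "\<forall>\<^sub>F s in at_top. capacity \<alpha> \<kappa> M s \<le> (SUP s\<in>{0<..}. capacity \<alpha> \<kappa> M s)"
      using eventually_gt_at_top[of 0] by (rule eventually_mono) (auto intro: cSUP_upper bdd)
    fix y assume "y < (SUP s\<in>{0<..}. capacity \<alpha> \<kappa> M s)"
    then obtain s where s: "0 < s" "y < capacity \<alpha> \<kappa> M s"
      by (subst (asm) less_cSUP_iff) (auto intro: bdd)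
    show "\<forall>\<^sub>F t in at_top. y < capacity \<alpha> \<kappa> M t"
      using eventually_ge_at_top[of s]
      by (rule eventually_mono) (use capacity_mono s in \<open>fastforce intro: less_le_trans\<close>)
  qed
  then show ?thesis by blast
qed

lemma capacity_limit_le:
  assumes "((\<lambda>s. capacity \<alpha> \<kappa> M s) \<longlongrightarrow> L) at_top" "\<And>s. 0 < s \<Longrightarrow> capacity \<alpha> \<kappa> M s \<le> c"
  shows "L \<le> c"
  by (rule tendsto_upperbound[OF assms(1)])
     (use assms(2) in \<open>auto intro: eventually_mono[OF eventually_gt_at_top[of 0]]\<close>)

text \<open>The shared core of two lower bounds: \<open>a / b\<close> is the limiting
  signal-to-distortion ratio, equal to \<open>1 / \<kappa>\<^sup>2\<close> for the uniform
  covariance and larger for the row-space projection of a wide deterministic channel. For the latter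
  the two identities are established only at the fixed channel matrix, hence the almost-everywhere
  form.\<close>

lemma capacity_limit_ge:
  fixes Q :: "complex^'t^'t"
  assumes lim: "((\<lambda>s. capacity \<alpha> \<kappa> M s) \<longlongrightarrow> L) at_top"
    and Q: "Q \<in> cov" and ab: "0 \<le> a" "0 < b"
    and AE1: "AE H in M. H ** Q ** cjt H = a *\<^sub>R (H ** cjt H)"
    and AE2: "AE H in M. H ** dg (ups \<alpha> \<kappa> Q) ** cjt H = b *\<^sub>R (H ** cjt H)"
  shows "real (min CARD('t) CARD('r)) * ln (1 + a / b) / ln 2 \<le> L"
proof -
  define f :: "real \<Rightarrow> complex^'t^'r \<Rightarrow> real" where "f = (\<lambda>s H. if 0 < s then nrate \<alpha> \<kappa> s Q H else 0)"
  have "((\<lambda>s. \<integral>H. f s H \<partial>M) \<longlongrightarrow> (\<integral>H. real (min CARD('t) CARD('r)) * ln (1 + a / b) \<partial>M)) at_top"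
  proof (rule integral_dominated_convergence_at_top[where w = "\<lambda>_. real (min CARD('t) CARD('r)) * ln (1 + real CARD('t) / (real (min CARD('t) CARD('r)) * \<kappa>\<^sup>2))"])
    show "f s \<in> borel_measurable M" for s
    proof (cases "0 < s")
      case True
      have "nrate \<alpha> \<kappa> s Q \<in> borel_measurable M"
        using True by (intro continuous_measurable continuous_on_nrate[OF \<alpha> \<kappa>] Q) auto
      then show ?thesis using True by (simp add: f_def)
    qed (simp add: f_def)
    show "AE H in M. ((\<lambda>s. f s H) \<longlongrightarrow> real (min CARD('t) CARD('r)) * ln (1 + a / b)) at_top"
      using AE1 AE2 AE_rank
    proof eventually_elim
      case (elim H)
      have "((\<lambda>s. nrate \<alpha> \<kappa> s Q H) \<longlongrightarrow> real (min CARD('t) CARD('r)) * ln (1 + a / b)) at_top"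
        unfolding nrate_def elim(1,2) elim(3)[symmetric] by (rule ldet_gram_limit[OF ab])
      then show ?case
        by (rule Lim_transform_eventually)
           (auto intro!: eventually_mono[OF eventually_gt_at_top[of 0]] simp: f_def)
    qed
    show "\<forall>\<^sub>F s in at_top. AE H in M. norm (f s H) \<le> real (min CARD('t) CARD('r)) * ln (1 + real CARD('t) / (real (min CARD('t) CARD('r)) * \<kappa>\<^sup>2))"
      using eventually_gt_at_top[of 0]
    proof (rule eventually_mono, intro AE_I2)
      fix s :: real and H assume s: "0 < s"
      show "norm (f s H) \<le> real (min CARD('t) CARD('r)) * ln (1 + real CARD('t) / (real (min CARD('t) CARD('r)) * \<kappa>\<^sup>2))"
        using s nrate_bound[OF Q s, of H] nrate_nonneg[OF \<alpha> \<kappa> Q, of s H] by (simp add: f_def)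
    qed
  qed auto
  then have "((\<lambda>s. (\<integral>H. f s H \<partial>M) / ln 2) \<longlongrightarrow> real (min CARD('t) CARD('r)) * ln (1 + a / b) / ln 2) at_top"
    by (intro tendsto_divide tendsto_const) (auto simp: prob_space)
  moreover have "\<forall>\<^sub>F s in at_top. (\<integral>H. f s H \<partial>M) / ln 2 \<le> capacity \<alpha> \<kappa> M s"
    using eventually_gt_at_top[of 0]
    by (rule eventually_mono) (use capacity_ge[OF _ Q] in \<open>auto simp: f_def\<close>)
  ultimately show ?thesis by (intro tendsto_le[OF _ lim]) auto
qed

lemma capacity_limit_ge_uniform:
  assumes "((\<lambda>s. capacity \<alpha> \<kappa> M s) \<longlongrightarrow> L) at_top"
  shows "real (min CARD('t) CARD('r)) * ln (1 + 1 / \<kappa>\<^sup>2) / ln 2 \<le> L"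
proof -
  let ?Q = "(1 / real CARD('t)) *\<^sub>R mat 1 :: complex^'t^'t"
  have "dg (ups \<alpha> \<kappa> ?Q) = (\<kappa>\<^sup>2 / real CARD('t)) *\<^sub>R mat 1"
    using dg_scaleR[of "\<kappa>\<^sup>2 / real CARD('t)" "\<lambda>_::'t. 1"] by (simp add: ups_uniform[abs_def] dg_1)
  then have "real (min CARD('t) CARD('r)) * ln (1 + (1 / real CARD('t)) / (\<kappa>\<^sup>2 / real CARD('t))) / ln 2 \<le> L"
    using \<kappa> by (intro capacity_limit_ge[OF assms uniform_in_cov])
       (auto simp: mult_scaleR_left mult_scaleR_right)
  then show ?thesis by simp
qed

end

context impaired_channel
begin

subsection \<open>Right-rotationally invariant channels\<close>

lemma integral_rotate:
  fixes f :: "complex^'t^'r \<Rightarrow> complex"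
  assumes "right_rot_inv M" "unitary U" "continuous_on UNIV f"
  shows "(\<integral>H. f H \<partial>M) = (\<integral>H. f (H ** U) \<partial>M)"
proof -
  have "continuous_on UNIV (\<lambda>H :: complex^'t^'r. H ** U)" by (intro continuous_intros)
  then have meas: "(\<lambda>H. H ** U) \<in> measurable M borel" by (rule continuous_measurable)
  have "(\<integral>H. f H \<partial>M) = (\<integral>H. f H \<partial>distr M borel (\<lambda>H. H ** U))"
    using assms(1,2) by (simp add: right_rot_inv_def)
  also have "\<dots> = (\<integral>H. f (H ** U) \<partial>M)"
    using assms(3) by (intro integral_distr meas borel_measurable_continuous_onI)
  finally show ?thesis .
qed

context
  fixes F :: "complex^'t^'r \<Rightarrow> complex^'r^'r"
  assumes rri: "right_rot_inv M"
    and F: "continuous_on UNIV F" "\<And>H. psd (F H)" "\<And>H. psd (mat 1 - F H)"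
    and F_flip: "\<And>k H. F (H ** sign_flip k) = F H"
begin

text \<open>The coefficient matrix of the trace of \<open>H ** Q ** cjt H ** F H\<close> as a linear
  function of \<open>Q\<close>. The function \<open>F\<close> will be the identity at low SNR and an
  inverse noise covariance at high SNR; both lie between 0 and 1.\<close>

definition sandwich :: "complex^'t^'r \<Rightarrow> complex^'t^'t" where
  "sandwich H = cjt H ** F H ** H"

lemma sandwich_rotate: "F (H ** U) = F H \<Longrightarrow> sandwich (H ** U) = cjt U ** sandwich H ** U"
  by (simp add: sandwich_def matrix_mul_assoc)

lemma continuous_on_sandwich: "continuous_on UNIV sandwich"
  unfolding sandwich_def[abs_def] by (intro continuous_intros F)

lemma trace_sandwich: "trace (sandwich H) = trace (H ** cjt H ** F H)"
  unfolding sandwich_def by (metis matrix_mul_assoc trace_mul_sym)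

lemma trace_conj_sandwich:
  "trace (H ** Q ** cjt H ** F H) = (\<Sum>i\<in>UNIV. \<Sum>j\<in>UNIV. Q $ i $ j * sandwich H $ j $ i)"
proof -
  have "trace (H ** Q ** cjt H ** F H) = trace (Q ** sandwich H)"
    unfolding sandwich_def by (metis matrix_mul_assoc trace_mul_sym)
  then show ?thesis by (simp add: trace_def matrix_matrix_mult_def[of Q])
qed

lemma integrable_sandwich: "integrable M (\<lambda>H. sandwich H $ i $ j)"
proof (rule frob_dominated_integrable)
  show "continuous_on UNIV (\<lambda>H. sandwich H $ i $ j)"
    by (intro continuous_on_component continuous_on_sandwich)
  fix H
  have "psd (sandwich H)"
    using psd_conj[OF F(2), of "cjt H" H] by (simp add: sandwich_def)
  then have "norm (sandwich H $ i $ j) \<le> Re (trace (sandwich H))"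
    by (rule psd_entry_le_trace)
  also have "\<dots> \<le> frob_sq H"
    using trace_psd_mult_nonneg[OF psd_mult_cjt[of H] F(3)[of H]]
    by (simp add: trace_sandwich mult_diff_right trace_sub trace_mult_cjt)
  finally show "norm (sandwich H $ i $ j) \<le> frob_sq H" .
qed

text \<open>Flipping coordinate \<open>i\<close> negates this entry but preserves the channel
  distribution, so the mean equals its own negative.\<close>

lemma integral_sandwich_off_diag:
  assumes "i \<noteq> j"
  shows "(\<integral>H. sandwich H $ i $ j \<partial>M) = 0"
proof -
  have "(\<integral>H. sandwich H $ i $ j \<partial>M) = (\<integral>H. sandwich (H ** sign_flip i) $ i $ j \<partial>M)"
    by (intro integral_rotate rri unitary_sign_flip continuous_on_component continuous_on_sandwich)
  also have "\<dots> = (\<integral>H. - (sandwich H $ i $ j) \<partial>M)"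
    using assms by (simp add: sandwich_rotate[OF F_flip] sign_flip_conj_nth)
  finally show ?thesis by simp
qed

lemma integrable_trace_sandwich: "integrable M (\<lambda>H. Re (trace (H ** Q ** cjt H ** F H)))"
  unfolding trace_conj_sandwich
  by (intro integrable_Re Bochner_Integration.integrable_sum integrable_mult_right integrable_sandwich)

text \<open>Only the diagonal of \<open>Q\<close> survives averaging, which later allows
  \<open>Q\<close> to be replaced by its diagonal part.\<close>

lemma integral_trace_sandwich:
  assumes "cjt Q = Q"
  shows "(\<integral>H. Re (trace (H ** Q ** cjt H ** F H)) \<partial>M)
    = (\<Sum>i\<in>UNIV. Re (Q $ i $ i) * Re (\<integral>H. sandwich H $ i $ i \<partial>M))"
proof -
  have "(\<integral>H. Re (trace (H ** Q ** cjt H ** F H)) \<partial>M)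
    = Re (\<integral>H. (\<Sum>i\<in>UNIV. \<Sum>j\<in>UNIV. Q $ i $ j * sandwich H $ j $ i) \<partial>M)"
    unfolding trace_conj_sandwich
    by (intro integral_Re Bochner_Integration.integrable_sum integrable_mult_right integrable_sandwich)
  also have "(\<integral>H. (\<Sum>i\<in>UNIV. \<Sum>j\<in>UNIV. Q $ i $ j * sandwich H $ j $ i) \<partial>M)
    = (\<Sum>i\<in>UNIV. \<Sum>j\<in>UNIV. Q $ i $ j * (\<integral>H. sandwich H $ j $ i \<partial>M))"
    by (simp add: Bochner_Integration.integral_sum integrable_sandwich)
  also have "\<dots> = (\<Sum>i\<in>UNIV. \<Sum>j\<in>UNIV. if j = i then Q $ i $ i * (\<integral>H. sandwich H $ i $ i \<partial>M) else 0)"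
    by (intro sum.cong refl) (auto simp: integral_sandwich_off_diag)
  also have "\<dots> = (\<Sum>i\<in>UNIV. of_real (Re (Q $ i $ i)) * (\<integral>H. sandwich H $ i $ i \<partial>M))"
    by (simp add: hermitian_diag_real[OF assms, symmetric])
  finally show ?thesis by simp
qed

text \<open>If \<open>F\<close> is invariant under all unitaries, swaps also equate the diagonal
  means. The mean sandwich is then scalar, and its value is read off from
  \<open>Q = mat 1\<close>.\<close>

lemma integral_trace_sandwich_uniform:
  assumes "cjt Q = Q" and F_rot: "\<And>U H. unitary U \<Longrightarrow> F (H ** U) = F H"
  shows "(\<integral>H. Re (trace (H ** Q ** cjt H ** F H)) \<partial>M)
    = Re (trace Q) / real CARD('t) * (\<integral>H. Re (trace (H ** cjt H ** F H)) \<partial>M)"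
proof -
  define w where "w = (\<lambda>i. Re (\<integral>H. sandwich H $ i $ i \<partial>M))"
  have w_eq: "w a = w b" for a b
  proof -
    have "(\<integral>H. sandwich H $ a $ a \<partial>M) = (\<integral>H. sandwich (H ** swap_mat a b) $ a $ a \<partial>M)"
      by (intro integral_rotate rri unitary_swap continuous_on_component continuous_on_sandwich)
    also have "\<dots> = (\<integral>H. sandwich H $ b $ b \<partial>M)"
      by (simp add: sandwich_rotate[OF F_rot[OF unitary_swap]] mult_swap_nth swap_mult_nth)
    finally show ?thesis by (simp add: w_def)
  qed
  obtain a :: 't where True by blast
  have *: "(\<integral>H. Re (trace (H ** Q ** cjt H ** F H)) \<partial>M) = Re (trace Q) * w a" if "cjt Q = Q" for Q
  proof -
    have "(\<Sum>i\<in>UNIV. Re (Q $ i $ i) * w i) = (\<Sum>i\<in>UNIV. Re (Q $ i $ i) * w a)"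
      by (intro sum.cong refl) (metis w_eq)
    then show ?thesis
      using integral_trace_sandwich[OF that] by (simp add: w_def trace_def sum_distrib_right)
  qed
  have "(\<integral>H. Re (trace (H ** cjt H ** F H)) \<partial>M) = real CARD('t) * w a"
    using *[of "mat 1"] by (simp add: trace_I)
  then show ?thesis using *[OF assms(1)] by simp
qed

end

lemma rri_low_slope:
  assumes rri: "right_rot_inv M"
  shows "low_slope = (\<integral>H. frob_sq H \<partial>M) / real CARD('t)"
proof (rule antisym[OF low_slope_le low_slope_ge_frob])
  fix Q :: "complex^'t^'t" assume Q: "Q \<in> cov"
  have "(\<integral>H. Re (trace (H ** Q ** cjt H ** mat 1)) \<partial>M)
    = Re (trace Q) / real CARD('t) * (\<integral>H. Re (trace (H ** cjt H ** mat 1)) \<partial>M)"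
    \<comment> \<open>With \<open>F\<close> constantly the identity, \<open>mat 1 - F H\<close> is
      the zero matrix, here obtained as a positive semidefinite matrix scaled by 0.\<close>
    using psd_scaleR[OF psd_mat_1, of 0] psd_hermitian[OF covD(1)[OF Q]]
    by (intro integral_trace_sandwich_uniform rri) (auto intro: continuous_intros psd_mat_1)
  then show "gain Q \<le> (\<integral>H. frob_sq H \<partial>M) / real CARD('t)"
    using covD(2)[OF Q] by (simp add: gain_def trace_mult_cjt)
qed

section \<open>Mean trace and capacity bounds under rotation invariance\<close>

lemma conj_sign_flip:
  fixes H :: "complex^'t^'r"
  shows "(H ** sign_flip k) ** dg d ** cjt (H ** sign_flip k) = H ** dg d ** cjt H"
proof -
  have "(H ** sign_flip k) ** dg d ** cjt (H ** sign_flip k)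
    = H ** (sign_flip k ** dg d ** sign_flip k) ** cjt H"
    by (simp add: matrix_mul_assoc)
  then show ?thesis by (simp add: sign_flip_conj_dg)
qed

lemma gram_rotate:
  fixes H :: "complex^'t^'r"
  assumes "unitary U"
  shows "(H ** U) ** cjt (H ** U) = H ** cjt H"
proof -
  have "(H ** U) ** cjt (H ** U) = H ** (U ** cjt U) ** cjt H"
    by (simp add: matrix_mul_assoc)
  then show ?thesis by (simp add: unitaryD[OF assms])
qed

text \<open>With isotropic distortion alone the noise inverse \<open>F H\<close> depends on
  \<open>H\<close> only through its Gram matrix. The identity
  \<open>c *\<^sub>R (H ** cjt H ** F H) = mat 1 - F H\<close> bounds the trace by
  \<open>CARD('r)\<close>. The factor \<open>\<alpha>\<^sup>2\<close> stays on the left: one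
  \<open>\<alpha>\<close> is absorbed into \<open>c\<close>, so \<open>\<alpha> = 0\<close> is
  covered without a division.\<close>

lemma rri_gram_trace_le:
  assumes rri: "right_rot_inv M" and "0 < s" "cjt Q = Q" "trace Q = 1"
  shows "\<alpha>\<^sup>2 * (\<integral>H. Re (trace (s *\<^sub>R (H ** Q ** cjt H) ** matrix_inv ((s * (\<kappa>\<^sup>2 * \<alpha> / real CARD('t))) *\<^sub>R (H ** cjt H) + mat 1))) \<partial>M)
    \<le> real CARD('r) * \<alpha> / \<kappa>\<^sup>2"
    and "integrable M (\<lambda>H. Re (trace (s *\<^sub>R (H ** Q ** cjt H) ** matrix_inv ((s * (\<kappa>\<^sup>2 * \<alpha> / real CARD('t))) *\<^sub>R (H ** cjt H) + mat 1))))"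
proof -
  define c where "c = s * (\<kappa>\<^sup>2 * \<alpha> / real CARD('t))"
  have c: "0 \<le> c" using assms \<alpha> by (simp add: c_def)
  define F where "F = (\<lambda>H :: complex^'t^'r. matrix_inv (c *\<^sub>R (H ** cjt H) + mat 1))"
  have pd: "pd (c *\<^sub>R (H ** cjt H) + mat 1)" for H :: "complex^'t^'r"
    by (intro pd_add_1 psd_scaleR psd_mult_cjt c)
  have F: "continuous_on UNIV F" "\<And>H. psd (F H)" "\<And>H. psd (mat 1 - F H)"
    "\<And>U H. unitary U \<Longrightarrow> F (H ** U) = F H"
    unfolding F_def using c
    by (auto intro!: continuous_on_matrix_inv continuous_intros pd psd_inv_add_1 psd_mult_cjt simp only: gram_rotate)
  have F_flip: "F (H ** sign_flip k) = F H" for k H by (rule F(4)[OF unitary_sign_flip])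
  have tr: "Re (trace (s *\<^sub>R (H ** Q ** cjt H) ** F H)) = s * Re (trace (H ** Q ** cjt H ** F H))" for H
    by (simp add: mult_scaleR_left trace_scaleR)
  have int: "integrable M (\<lambda>H. Re (trace (H ** Q ** cjt H ** F H)))" for Q
    by (rule integrable_trace_sandwich[OF rri F(1-3) F_flip])
  then show "integrable M (\<lambda>H. Re (trace (s *\<^sub>R (H ** Q ** cjt H) ** matrix_inv ((s * (\<kappa>\<^sup>2 * \<alpha> / real CARD('t))) *\<^sub>R (H ** cjt H) + mat 1))))"
    unfolding F_def[folded c_def, THEN fun_cong, symmetric] c_def[symmetric] tr by (intro integrable_mult_right)
  have "c * Re (trace (H ** cjt H ** F H)) \<le> real CARD('r)" for H
  proof -
    have "(c *\<^sub>R (H ** cjt H) + mat 1) ** F H = mat 1"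
      unfolding F_def by (rule pd_inv(1)[OF pd])
    then have "c *\<^sub>R (H ** cjt H ** F H) = mat 1 - F H"
      by (simp add: mult_add_left mult_scaleR_left eq_diff_eq)
    then have "c * Re (trace (H ** cjt H ** F H)) = Re (trace (mat 1 - F H))"
      by (simp flip: trace_scaleR scaleR_complex.sel(1))
    also have "\<dots> \<le> real CARD('r)"
      using psd_trace_nonneg[OF F(2)[of H]] by (simp add: trace_sub trace_I)
    finally show ?thesis .
  qed
  then have "(\<integral>H. c * Re (trace (H ** cjt H ** F H)) \<partial>M) \<le> real CARD('r)"
    using int[of "mat 1"] by (intro integral_le_const integrable_mult_right AE_I2) auto
  then have le: "c * (\<integral>H. Re (trace (H ** cjt H ** F H)) \<partial>M) \<le> real CARD('r)" by simp
  have "\<alpha>\<^sup>2 * (\<integral>H. Re (trace (s *\<^sub>R (H ** Q ** cjt H) ** F H)) \<partial>M)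
    = \<alpha>\<^sup>2 * (s * (\<integral>H. Re (trace (H ** cjt H ** F H)) \<partial>M)) / real CARD('t)"
    using integral_trace_sandwich_uniform[OF rri F(1-3) F_flip assms(3) F(4)]
    by (simp add: tr assms(4))
  also have "\<dots> = \<alpha> / \<kappa>\<^sup>2 * (c * (\<integral>H. Re (trace (H ** cjt H ** F H)) \<partial>M))"
    using \<kappa> by (simp add: c_def power2_eq_square field_simps)
  also have "\<dots> \<le> \<alpha> / \<kappa>\<^sup>2 * real CARD('r)"
    using \<alpha> le by (intro mult_left_mono) auto
  finally show "\<alpha>\<^sup>2 * (\<integral>H. Re (trace (s *\<^sub>R (H ** Q ** cjt H) ** matrix_inv ((s * (\<kappa>\<^sup>2 * \<alpha> / real CARD('t))) *\<^sub>R (H ** cjt H) + mat 1))) \<partial>M)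
    \<le> real CARD('r) * \<alpha> / \<kappa>\<^sup>2"
    by (simp add: F_def c_def mult.commute)
qed

lemma rri_trace_le:
  assumes rri: "right_rot_inv M" and Q: "Q \<in> cov" and s: "0 < s"
  shows "(\<integral>H. Re (trace (s *\<^sub>R (H ** Q ** cjt H) ** matrix_inv (s *\<^sub>R (H ** dg (ups \<alpha> \<kappa> Q) ** cjt H) + mat 1))) \<partial>M)
      \<le> real CARD('r) / \<kappa>\<^sup>2"
    and "integrable M (\<lambda>H. Re (trace (s *\<^sub>R (H ** Q ** cjt H) ** matrix_inv (s *\<^sub>R (H ** dg (ups \<alpha> \<kappa> Q) ** cjt H) + mat 1))))"
proof -
  define F where "F = (\<lambda>H :: complex^'t^'r. matrix_inv (s *\<^sub>R (H ** dg (ups \<alpha> \<kappa> Q) ** cjt H) + mat 1))"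
  \<comment> \<open>\<open>D\<close> is the diagonal of \<open>Q\<close>. The distortion depends on
    \<open>Q\<close> only through it, and by flip invariance so does the mean signal trace.\<close>
  define D :: "complex^'t^'t" where "D = dg (\<lambda>n. Re (Q $ n $ n))"
  have D: "psd D" "trace D = 1" "cjt D = D"
    using cov_diag[OF Q] by (auto simp: D_def trace_dg intro!: psd_dg simp flip: of_real_sum)
  have D_nn: "Re (D $ n $ n) = Re (Q $ n $ n)" for n by (simp add: D_def dg_def)
  have F: "continuous_on UNIV F" "\<And>H. psd (F H)" "\<And>H. psd (mat 1 - F H)"
    unfolding F_def using s
    by (auto intro!: continuous_on_matrix_inv continuous_intros nrate_psd[OF \<alpha> \<kappa> Q] psd_inv_add_1)
  have F_flip: "F (H ** sign_flip k) = F H" for k H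
    unfolding F_def conj_sign_flip ..
  have tr: "Re (trace (s *\<^sub>R (H ** Q ** cjt H) ** F H)) = s * Re (trace (H ** Q ** cjt H ** F H))" for H Q
    by (simp add: mult_scaleR_left trace_scaleR)
  have int: "integrable M (\<lambda>H. Re (trace (s *\<^sub>R (H ** Q ** cjt H) ** F H)))" for Q
    unfolding tr by (intro integrable_mult_right integrable_trace_sandwich[OF rri F(1-3) F_flip])
  then show "integrable M (\<lambda>H. Re (trace (s *\<^sub>R (H ** Q ** cjt H) ** matrix_inv (s *\<^sub>R (H ** dg (ups \<alpha> \<kappa> Q) ** cjt H) + mat 1))))"
    unfolding F_def .
  define Y where "Y = (\<lambda>H :: complex^'t^'r. (s * (\<kappa>\<^sup>2 * \<alpha> / real CARD('t))) *\<^sub>R (H ** cjt H) + mat 1)"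
  \<comment> \<open>The noise is a multiple of the signal covariance of \<open>D\<close> plus the
    isotropic part \<open>Y H\<close>: the shape required by
    \<open>trace_diag_inv_le\<close>.\<close>
  have split: "s *\<^sub>R (H ** dg (ups \<alpha> \<kappa> Q) ** cjt H) + mat 1
      = (\<kappa>\<^sup>2 * (1 - \<alpha>)) *\<^sub>R (s *\<^sub>R (H ** D ** cjt H)) + Y H" for H :: "complex^'t^'r"
  proof -
    have "dg (ups \<alpha> \<kappa> Q) = (\<kappa>\<^sup>2 * (1 - \<alpha>)) *\<^sub>R D + (\<kappa>\<^sup>2 * \<alpha> / real CARD('t)) *\<^sub>R mat 1"
      unfolding D_def dg_1[symmetric] dg_scaleR dg_add
      by (rule arg_cong[of _ _ dg]) (auto simp: ups_def algebra_simps)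
    then show ?thesis
      by (simp add: Y_def mult_add_left mult_add_right mult_scaleR_left mult_scaleR_right
          scaleR_add_right mult_ac)
  qed
  have "(\<integral>H. Re (trace (s *\<^sub>R (H ** Q ** cjt H) ** F H)) \<partial>M)
    = (\<integral>H. Re (trace (s *\<^sub>R (H ** D ** cjt H) ** F H)) \<partial>M)"
    using integral_trace_sandwich[OF rri F(1-3) F_flip psd_hermitian[OF covD(1)[OF Q]]]
      integral_trace_sandwich[OF rri F(1-3) F_flip D(3)]
    by (simp add: tr D_nn)
  also have "\<dots> \<le> (\<integral>H. real CARD('r) * (1 - \<alpha>) / \<kappa>\<^sup>2
      + \<alpha>\<^sup>2 * Re (trace (s *\<^sub>R (H ** D ** cjt H) ** matrix_inv (Y H))) \<partial>M)"
  proof (rule integral_mono)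
    show "integrable M (\<lambda>H. real CARD('r) * (1 - \<alpha>) / \<kappa>\<^sup>2
      + \<alpha>\<^sup>2 * Re (trace (s *\<^sub>R (H ** D ** cjt H) ** matrix_inv (Y H))))"
      unfolding Y_def by (intro Bochner_Integration.integrable_add integrable_mult_right rri_gram_trace_le(2) rri s D) simp
    fix H
    have "pd (Y H)" unfolding Y_def using s \<alpha> by (intro pd_add_1 psd_scaleR psd_mult_cjt) auto
    then show "Re (trace (s *\<^sub>R (H ** D ** cjt H) ** F H)) \<le> real CARD('r) * (1 - \<alpha>) / \<kappa>\<^sup>2
      + \<alpha>\<^sup>2 * Re (trace (s *\<^sub>R (H ** D ** cjt H) ** matrix_inv (Y H)))"
      unfolding F_def split using s
      by (intro trace_diag_inv_le[OF \<alpha> \<kappa>] psd_scaleR psd_conj D) auto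
  qed (rule int)
  also have "\<dots> = real CARD('r) * (1 - \<alpha>) / \<kappa>\<^sup>2
      + \<alpha>\<^sup>2 * (\<integral>H. Re (trace (s *\<^sub>R (H ** D ** cjt H) ** matrix_inv (Y H))) \<partial>M)"
    using rri_gram_trace_le(2)[OF rri s D(3,2)] by (simp add: Y_def prob_space)
  also have "\<dots> \<le> real CARD('r) * (1 - \<alpha>) / \<kappa>\<^sup>2 + real CARD('r) * \<alpha> / \<kappa>\<^sup>2"
    unfolding Y_def by (intro add_left_mono rri_gram_trace_le(1) rri s D)
  also have "\<dots> = real CARD('r) / \<kappa>\<^sup>2"
    by (simp add: add_divide_distrib[symmetric] algebra_simps)
  finally show "(\<integral>H. Re (trace (s *\<^sub>R (H ** Q ** cjt H) ** matrix_inv (s *\<^sub>R (H ** dg (ups \<alpha> \<kappa> Q) ** cjt H) + mat 1))) \<partial>M)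
      \<le> real CARD('r) / \<kappa>\<^sup>2"
    by (simp add: F_def)
qed

text \<open>For N_t \<le> N_r the general cap is already this value. Otherwise
  \<open>\<theta> = 1 + 1 / \<kappa>\<^sup>2\<close> puts the tangent at the average eigenvalue
  allowed by the mean trace bound; being the same for all \<open>H\<close>, it commutes with the
  expectation.\<close>

lemma rri_capacity_le:
  assumes rri: "right_rot_inv M" and s: "0 < s"
  shows "capacity \<alpha> \<kappa> M s \<le> real (min CARD('t) CARD('r)) * ln (1 + 1 / \<kappa>\<^sup>2) / ln 2"
proof (cases "CARD('t) \<le> CARD('r)")
  case True
  then show ?thesis using capacity_le_bound[OF s] by (simp add: min_def)
next
  case False
  then have m: "min CARD('t) CARD('r) = CARD('r)" by simp
  show ?thesis
    unfolding m
  proof (rule capacity_le)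
    fix Q :: "complex^'t^'t" assume Q: "Q \<in> cov"
    define \<theta> where "\<theta> = 1 + 1 / \<kappa>\<^sup>2"
    have \<theta>: "1 \<le> \<theta>" by (simp add: \<theta>_def)
    define T where "T = (\<lambda>H :: complex^'t^'r. Re (trace (s *\<^sub>R (H ** Q ** cjt H) ** matrix_inv (s *\<^sub>R (H ** dg (ups \<alpha> \<kappa> Q) ** cjt H) + mat 1))))"
    have T: "integrable M T" "(\<integral>H. T H \<partial>M) \<le> real CARD('r) / \<kappa>\<^sup>2"
      using rri_trace_le[OF rri Q s] by (simp_all add: T_def)
    have "(\<integral>H. nrate \<alpha> \<kappa> s Q H \<partial>M)
      \<le> (\<integral>H. real CARD('r) * (ln \<theta> + 1 / \<theta> - 1) + T H / \<theta> \<partial>M)"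
    proof (rule integral_mono[OF integrable_nrate[OF Q s]])
      show "integrable M (\<lambda>H. real CARD('r) * (ln \<theta> + 1 / \<theta> - 1) + T H / \<theta>)"
        using T by simp
      fix H :: "complex^'t^'r"
      have "rank (s *\<^sub>R (H ** Q ** cjt H)) \<le> CARD('r)"
        using rank_le_dims[of "s *\<^sub>R (H ** Q ** cjt H)"] by simp
      then show "nrate \<alpha> \<kappa> s Q H \<le> real CARD('r) * (ln \<theta> + 1 / \<theta> - 1) + T H / \<theta>"
        unfolding nrate_def T_def using s \<theta>
        by (intro ldet_le_tangent nrate_psd[OF \<alpha> \<kappa> Q]) auto
    qed
    also have "\<dots> = real CARD('r) * (ln \<theta> + 1 / \<theta> - 1) + (\<integral>H. T H \<partial>M) / \<theta>"
      using T by (simp add: prob_space)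
    also have "\<dots> \<le> real CARD('r) * (ln \<theta> + 1 / \<theta> - 1) + (real CARD('r) / \<kappa>\<^sup>2) / \<theta>"
      using T \<theta> by (intro add_left_mono divide_right_mono) auto
    also have "\<dots> = real CARD('r) * (ln \<theta> + (1 + 1 / \<kappa>\<^sup>2) / \<theta> - 1)"
      by (simp add: algebra_simps add_divide_distrib)
    also have "\<dots> = real CARD('r) * ln (1 + 1 / \<kappa>\<^sup>2)"
      unfolding \<theta>_def[symmetric] using \<theta> by simp
    finally show "(\<integral>H. nrate \<alpha> \<kappa> s Q H \<partial>M) \<le> real CARD('r) * ln (1 + 1 / \<kappa>\<^sup>2)" .
  qed
qed

subsection \<open>Deterministic channels\<close>

context
  fixes H0 :: "complex^'t^'r"
  assumes M_return: "M = return borel H0"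
begin

lemma integral_deterministic: "continuous_on UNIV f \<Longrightarrow> (\<integral>H. f H \<partial>M) = (f H0 :: real)"
  unfolding M_return by (rule integral_return) (auto intro: borel_measurable_continuous_onI)

lemma AE_deterministic: "AE H in M. H = H0"
  unfolding M_return by (subst AE_return) auto

lemma rank_deterministic: "rank H0 = min CARD('t) CARD('r)"
proof -
  have "AE H in M. rank H0 = min CARD('t) CARD('r)"
    using AE_rank AE_deterministic by eventually_elim simp
  then show ?thesis by simp
qed

text \<open>Beamforming along any \<open>v\<close> has gain equal to the squared ratio of the norms
  of \<open>H0 *v v\<close> and \<open>v\<close>, so the square root of the slope is an operator
  bound for \<open>H0\<close>. This avoids choosing a maximizing direction.\<close>

lemma deterministic_low_slope: "low_slope = (\<integral>H. (spec_norm H)\<^sup>2 \<partial>M)"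
proof (rule antisym[OF low_slope_le_spec])
  have gain: "gain Q = Re (trace (H0 ** Q ** cjt H0))" for Q
    unfolding gain_def by (rule integral_deterministic[OF continuous_on_trace_conj])
  have nn: "0 \<le> low_slope"
    using low_slope_ge_frob integral_frob_sq by (metis divide_nonneg_nonneg mult_nonneg_nonneg of_nat_0_le_iff order_trans)
  have "norm (H0 *v v) \<le> sqrt low_slope * norm v" for v
  proof (cases "v = 0")
    case True
    then show ?thesis by simp
  next
    case False
    \<comment> \<open>The vector as a one-column matrix, so that the rank-one covariance is a Gram
      matrix and its traces are Frobenius norms.\<close>
    define W :: "complex^1^'t" where "W = (\<chi> i j. v $ i)"
    have frob_W: "frob_sq W = (norm v)\<^sup>2"
      by (simp add: frob_sq_def W_def norm_vec_def L2_set_def sum_nonneg)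
    have "frob_sq (H0 ** W) = (\<Sum>i\<in>UNIV. (cmod ((H0 *v v) $ i))\<^sup>2)"
      by (simp add: frob_sq_def W_def matrix_matrix_mult_def matrix_vector_mult_def)
    then have frob_HW: "frob_sq (H0 ** W) = (norm (H0 *v v))\<^sup>2"
      by (simp add: norm_vec_def[of "H0 *v v"] L2_set_def sum_nonneg)
    define Q where "Q = (1 / (norm v)\<^sup>2) *\<^sub>R (W ** cjt W)"
    have "trace Q = 1"
      using False by (simp add: Q_def trace_scaleR trace_mult_cjt frob_W scaleR_conv_of_real[where 'a=complex])
    then have "Q \<in> cov" by (simp add: cov_def Q_def psd_scaleR psd_mult_cjt)
    have "trace (H0 ** Q ** cjt H0) = (1 / (norm v)\<^sup>2) *\<^sub>R trace ((H0 ** W) ** cjt (H0 ** W))"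
      by (simp add: Q_def mult_scaleR_left mult_scaleR_right trace_scaleR matrix_mul_assoc)
    then have "gain Q = (norm (H0 *v v))\<^sup>2 / (norm v)\<^sup>2"
      unfolding gain trace_mult_cjt frob_HW by simp
    then have "(norm (H0 *v v))\<^sup>2 \<le> low_slope * (norm v)\<^sup>2"
      using gain_le_low_slope[OF \<open>Q \<in> cov\<close>] False by (simp add: pos_divide_le_eq)
    then have "(norm (H0 *v v))\<^sup>2 \<le> (sqrt low_slope * norm v)\<^sup>2"
      using nn by (simp add: power_mult_distrib)
    then show ?thesis by (rule power2_le_imp_le) (simp add: nn)
  qed
  then have "spec_norm H0 \<le> sqrt low_slope"
    unfolding spec_norm_def by (intro onorm_le)
  then have "(spec_norm H0)\<^sup>2 \<le> low_slope"
    using nn spec_norm_nonneg[of H0] power_mono[of "spec_norm H0" "sqrt low_slope" 2] by simp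
  moreover have "(\<integral>H. (spec_norm H)\<^sup>2 \<partial>M) = (spec_norm H0)\<^sup>2"
    by (rule integral_deterministic[OF continuous_on_power[OF continuous_on_spec_norm]])
  ultimately show "(\<integral>H. (spec_norm H)\<^sup>2 \<partial>M) \<le> low_slope"
    by (simp only:)
qed

text \<open>For N_t > N_r power is confined to the row space of the known channel. As
  \<open>\<alpha> = 1\<close> the distortion spreads evenly over the antennas whatever
  \<open>Q\<close> is, so the signal gains by the factor N_t / N_r over uniform power while the
  distortion stays the same.\<close>

lemma deterministic_capacity_limit_ge:
  assumes lim: "((\<lambda>s. capacity \<alpha> \<kappa> M s) \<longlongrightarrow> L) at_top" and "\<alpha> = 1"
  shows "real (min CARD('t) CARD('r)) * ln (1 + real CARD('t) / (real (min CARD('t) CARD('r)) * \<kappa>\<^sup>2)) / ln 2 \<le> L"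
proof (cases "CARD('t) \<le> CARD('r)")
  case True
  then show ?thesis using capacity_limit_ge_uniform[OF lim] by (simp add: min_def)
next
  case False
  let ?r = "real CARD('r)"
  have m: "min CARD('t) CARD('r) = CARD('r)" using False by simp
  have pd: "pd (H0 ** cjt H0)"
  proof -
    obtain U d where U: "unitary U" "H0 ** cjt H0 = U ** dg d ** cjt U" "\<And>i. 0 \<le> d i"
      using psd_spectral[OF psd_mult_cjt[of H0]] by blast
    have "card {i. d i \<noteq> 0} = CARD('r)"
      using rank_gram[OF U(1,2)] rank_deterministic m by simp
    then have "{i. d i \<noteq> 0} = UNIV" by (intro card_subset_eq) auto
    then have "det (H0 ** cjt H0) \<noteq> 0"
      by (auto simp: U(2) det_unitary_conj[OF U(1)] det_dg)
    then show ?thesis by (simp add: pd_def psd_mult_cjt)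
  qed
  define K where "K = matrix_inv (H0 ** cjt H0)"
  define Q where "Q = (1 / ?r) *\<^sub>R (cjt H0 ** K ** H0)"
  have "trace (cjt H0 ** K ** H0) = trace (H0 ** cjt H0 ** K)"
    by (metis matrix_mul_assoc trace_mul_sym)
  also have "\<dots> = of_real ?r" by (simp add: K_def pd_inv(1)[OF pd] trace_I)
  finally have "trace Q = 1" by (simp add: Q_def trace_scaleR scaleR_conv_of_real[where 'a=complex])
  moreover have "psd (cjt H0 ** K ** H0)"
    using psd_conj[OF pd_inv(3)[OF pd], of "cjt H0"] by (simp add: K_def)
  ultimately have Q: "Q \<in> cov" by (simp add: cov_def Q_def psd_scaleR)
  have "H0 ** Q ** cjt H0 = (1 / ?r) *\<^sub>R ((H0 ** cjt H0 ** K) ** (H0 ** cjt H0))"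
    by (simp add: Q_def mult_scaleR_left mult_scaleR_right matrix_mul_assoc)
  then have 1: "H0 ** Q ** cjt H0 = (1 / ?r) *\<^sub>R (H0 ** cjt H0)"
    by (simp add: K_def pd_inv(1)[OF pd])
  have "dg (ups \<alpha> \<kappa> Q) = (\<kappa>\<^sup>2 / real CARD('t)) *\<^sub>R mat 1"
    unfolding dg_1[symmetric] dg_scaleR by (rule arg_cong[of _ _ dg]) (auto simp: ups_def assms(2))
  then have 2: "H0 ** dg (ups \<alpha> \<kappa> Q) ** cjt H0 = (\<kappa>\<^sup>2 / real CARD('t)) *\<^sub>R (H0 ** cjt H0)"
    by (simp add: mult_scaleR_left mult_scaleR_right)
  have "real (min CARD('t) CARD('r)) * ln (1 + (1 / ?r) / (\<kappa>\<^sup>2 / real CARD('t))) / ln 2 \<le> L"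
  proof (rule capacity_limit_ge[OF lim Q])
    show "AE H in M. H ** Q ** cjt H = (1 / ?r) *\<^sub>R (H ** cjt H)"
      using AE_deterministic by eventually_elim (simp add: 1)
    show "AE H in M. H ** dg (ups \<alpha> \<kappa> Q) ** cjt H = (\<kappa>\<^sup>2 / real CARD('t)) *\<^sub>R (H ** cjt H)"
      using AE_deterministic by eventually_elim (simp add: 2)
  qed (use \<kappa> in auto)
  then show ?thesis unfolding m by (simp add: mult.commute)
qed

end

end

section \<open>The multiplexing gain as a quotient of two capacities\<close>

theorem theorem2:
  fixes M :: "(complex^'t^'r) measure"
    and M1 :: "(complex^1^1) measure"
    and \<alpha> \<kappa> :: real
  assumes "channel M" and "channel M1"
    and "0 \<le> \<alpha>" and "\<alpha> \<le> 1" and "0 < \<kappa>"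
  defines "mg \<equiv> (\<lambda>snr. capacity \<alpha> \<kappa> M snr / capacity \<alpha> \<kappa> M1 snr)"
    and "low0 \<equiv> (\<integral>H. frob_sq H \<partial>M) / (real CARD('t) * (\<integral>h. frob_sq h \<partial>M1))"
    and "up0 \<equiv> (\<integral>H. (spec_norm H)\<^sup>2 \<partial>M) / (\<integral>h. frob_sq h \<partial>M1)"
    and "upinf \<equiv> real (min CARD('t) CARD('r)) * log 2 (1 + real CARD('t) / (real (min CARD('t) CARD('r)) * \<kappa>\<^sup>2)) / log 2 (1 + 1 / \<kappa>\<^sup>2)"
  shows "(\<exists>L. (mg \<longlongrightarrow> L) (at_right 0) \<and> low0 \<le> L \<and> L \<le> up0)
       \<and> (\<exists>L. (mg \<longlongrightarrow> L) at_top \<and> (real (min CARD('t) CARD('r))) \<le> L \<and> L \<le> upinf)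
       \<and> ((\<exists>H0. M = return borel H0) \<and> \<alpha> = 1 \<longrightarrow>
            (mg \<longlongrightarrow> up0) (at_right 0) \<and> (mg \<longlongrightarrow> upinf) at_top)
       \<and> (right_rot_inv M \<longrightarrow>
            (mg \<longlongrightarrow> low0) (at_right 0) \<and> (mg \<longlongrightarrow> real (min CARD('t) CARD('r))) at_top)"
proof -
  interpret X: impaired_channel M \<alpha> \<kappa> using assms by unfold_locales
  interpret Y: impaired_channel M1 \<alpha> \<kappa> using assms by unfold_locales
  define m where "m = real (min CARD('t) CARD('r))"
  define e where "e = (\<integral>h. frob_sq h \<partial>M1)"
  have e: "e = 1" using Y.integral_frob_sq by (simp add: e_def)
  \<comment> \<open>With one transmit antenna the lower bound is the mean of \<open>frob_sq\<close>,
    which also dominates the spectral upper bound; the slope is squeezed between them.\<close>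
  have "Y.low_slope = e"
  proof (rule antisym)
    have "(\<integral>h. (spec_norm h)\<^sup>2 \<partial>M1) \<le> e"
      unfolding e_def by (intro integral_mono Y.integrable_spec_sq Y.integrable_frob_sq spec_sq_le_frob)
    then show "Y.low_slope \<le> e" using Y.low_slope_le_spec by simp
    show "e \<le> Y.low_slope" using Y.low_slope_ge_frob by (simp add: e_def)
  qed
  \<comment> \<open>Both capacities vanish as the SNR tends to 0; dividing each by \<open>s\<close>
    turns their quotient into one of slopes with a nonzero denominator.\<close>
  have "((\<lambda>s. (capacity \<alpha> \<kappa> M s / s) / (capacity \<alpha> \<kappa> M1 s / s))
      \<longlongrightarrow> (X.low_slope / ln 2) / (Y.low_slope / ln 2)) (at_right 0)"
    by (intro tendsto_divide X.capacity_div_limit Y.capacity_div_limit) (simp add: \<open>Y.low_slope = e\<close> e)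
  then have "((\<lambda>s. (capacity \<alpha> \<kappa> M s / s) / (capacity \<alpha> \<kappa> M1 s / s)) \<longlongrightarrow> X.low_slope / e) (at_right 0)"
    by (simp add: \<open>Y.low_slope = e\<close>)
  then have lim0: "(mg \<longlongrightarrow> X.low_slope / e) (at_right 0)"
    by (rule Lim_transform_eventually)
       (rule eventually_mono[OF eventually_at_right_less], simp add: mg_def)
  have low0: "low0 = ((\<integral>H. frob_sq H \<partial>M) / real CARD('t)) / e"
    by (simp add: low0_def e_def)
  have up0: "up0 = (\<integral>H. (spec_norm H)\<^sup>2 \<partial>M) / e"
    by (simp add: up0_def e_def)
  have bounds0: "low0 \<le> X.low_slope / e" "X.low_slope / e \<le> up0"
    unfolding low0 up0 using X.low_slope_ge_frob X.low_slope_le_spec e by simp_all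

  define c where "c = ln (1 + 1 / \<kappa>\<^sup>2) / ln 2"
  have c: "0 < c" using \<open>0 < \<kappa>\<close> by (simp add: c_def ln_gt_zero)
  have upinf: "upinf = (m * ln (1 + real CARD('t) / (m * \<kappa>\<^sup>2)) / ln 2) / c"
    by (simp add: upinf_def m_def c_def log_def)
  obtain L1 where L1: "((\<lambda>s. capacity \<alpha> \<kappa> M1 s) \<longlongrightarrow> L1) at_top"
    using Y.capacity_limit_exists by blast
  \<comment> \<open>For one antenna on each side the high-SNR lower bound and the distortion cap are
    the same number.\<close>
  have "L1 = c"
    using Y.capacity_limit_ge_uniform[OF L1] Y.capacity_limit_le[OF L1 Y.capacity_le_bound]
    by (simp add: c_def)
  obtain L where L: "((\<lambda>s. capacity \<alpha> \<kappa> M s) \<longlongrightarrow> L) at_top"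
    using X.capacity_limit_exists by blast
  have liminf: "(mg \<longlongrightarrow> L / c) at_top"
    unfolding mg_def using c L1 by (intro tendsto_divide L) (auto simp: \<open>L1 = c\<close>)
  have L_ge: "m * c \<le> L"
    using X.capacity_limit_ge_uniform[OF L] by (simp add: m_def c_def)
  have L_le: "L \<le> m * ln (1 + real CARD('t) / (m * \<kappa>\<^sup>2)) / ln 2"
    unfolding m_def by (rule X.capacity_limit_le[OF L X.capacity_le_bound])
  have boundsinf: "m \<le> L / c" "L / c \<le> upinf"
    unfolding upinf using L_ge L_le c by (simp_all add: pos_le_divide_eq divide_right_mono)

  have det: "(mg \<longlongrightarrow> up0) (at_right 0) \<and> (mg \<longlongrightarrow> upinf) at_top"
    if "M = return borel H0" "\<alpha> = 1" for H0
  proof -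
    have "X.low_slope / e = up0"
      using X.deterministic_low_slope[OF that(1)] by (simp add: up0)
    moreover have "L = m * ln (1 + real CARD('t) / (m * \<kappa>\<^sup>2)) / ln 2"
      using L_le X.deterministic_capacity_limit_ge[OF that(1) L that(2)] by (simp add: m_def)
    then have "L / c = upinf" unfolding upinf by simp
    ultimately show ?thesis using lim0 liminf by simp
  qed
  have rri: "(mg \<longlongrightarrow> low0) (at_right 0) \<and> (mg \<longlongrightarrow> m) at_top" if "right_rot_inv M"
  proof -
    have "X.low_slope / e = low0"
      using X.rri_low_slope[OF that] by (simp add: low0)
    moreover have "L \<le> m * ln (1 + 1 / \<kappa>\<^sup>2) / ln 2"
      unfolding m_def by (rule X.capacity_limit_le[OF L X.rri_capacity_le[OF that]])
    then have "L = m * c" using L_ge by (simp add: c_def)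
    then have "L / c = m" using c by simp
    ultimately show ?thesis using lim0 liminf by simp
  qed
  show ?thesis
    using lim0 bounds0 liminf boundsinf det rri unfolding m_def by blast
qed

end
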